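(* Let $\bar n\in\mathbf{N}$ and let ${\bold H}$ be a function with domain $\omega$ whose values ${\bold H}(i)$ are countable sets with at least two elements. Then: (1) the forcing notion $\mathbb{Q}^{\bold H}_{\bar n}$ is $\sigma$-$*$--linked; (2) conditions $p_0,p_1\in\mathbb{Q}^{\bold H}_{\bar n}$ are compatible in $\mathbb{Q}^{\bold H}_{\bar n}$ if and only if $\mathrm{POS}(p_0)\cap\mathrm{POS}(p_1)\neq\emptyset$; (3) $\mathbb{Q}^{\bold H}_{\bar n}$ is a Souslin ccc forcing notion.
   Context: $\mathbf{N}$ is the set of sequences $\bar n=\langle n^0_m,n^1_m:m<\omega\rangle$ of integers with $4<n^0_m\leq n^1_m<n^0_{m+1}$ for all $m$, $2^{2(m^*+2)}\sum_{m<m^*}n^0_m n^1_m<n^0_{m^*}$ for every $m^*\in\omega$, and $\lim_{m\to\infty}(n^1_m)^{1/(2n^0_m)}=\infty$. Conditions of $\mathbb{Q}^{\bold H}_{\bar n}$ are sequences $p=(w^p,\sigma^p_0,\sigma^p_1,\dots)$ of finite functions with pairwise disjoint domains, $w^p(i),\sigma^p_j(i)\in{\bold H}(i)$, such that for some $m^*=m^*(p)<\omega$ there is a partition $\langle V^p_m:m^*\leq m<\omega\rangle$ of $\omega$ with $|V^p_m|\leq n^1_m2^{m^*}$ and $|\mathrm{dom}(\sigma^p_j)|\geq n^0_m/2^{m^*}$ for $j\in V^p_m$. $\mathrm{POS}(p)=\{\eta\in\prod_{i\in\omega}{\bold H}(i): w^p\subseteq\eta,\ \sigma^p_j\not\subseteq\eta\text{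 for all }j\}$, and $p\leq q$ ($q$ stronger) iff $\mathrm{POS}(q)\subseteq\mathrm{POS}(p)$. A forcing notion $\mathbb{Q}$ is $\sigma$-$*$--linked if for every $n\in\omega$ there is a partition $\langle A_i:i\in\omega\rangle$ of $\mathbb{Q}$ such that any $q_0,\dots,q_n$ in one $A_i$ have a common upper bound. Conditions are regarded as points of the Polish space of all sequences $(w,\sigma_0,\sigma_1,\dots)$ of finite functions with $w(i),\sigma_j(i)\in{\bold H}(i)$ (product of discrete spaces); a forcing notion is Souslin if the set of conditions, the order relation and the incompatibility relation are $\Sigma^1_1$ subsets of this space and of its square, and Souslin ccc if additionally it satisfies the countable chain condition. *)

theory Defs
  imports "HOL-Analysis.Analysis"
begin

text \<open>A parameter nbar is given by the two sequences n0 (the n^0_m) and n1 (the n^1_m).\<close>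
definition in_N :: "(nat \<Rightarrow> nat) \<Rightarrow> (nat \<Rightarrow> nat) \<Rightarrow> bool" where
  "in_N n0 n1 \<longleftrightarrow>
     (\<forall>m. 4 < n0 m \<and> n0 m \<le> n1 m \<and> n1 m < n0 (Suc m)) \<and>
     (\<forall>mstar. 2 ^ (2 * (mstar + 2)) * (\<Sum>m<mstar. n0 m * n1 m) < n0 mstar) \<and>
     filterlim (\<lambda>m. real (n1 m) powr (1 / (2 * real (n0 m)))) at_top sequentially"

definition finfuns :: "(nat \<Rightarrow> 'a set) \<Rightarrow> (nat \<Rightarrow> 'a option) set" where
  "finfuns H = {f. finite (dom f) \<and> (\<forall>i x. f i = Some x \<longrightarrow> x \<in> H i)}"

text \<open>A sequence (w, sigma_0, sigma_1, ...) is represented as s :: nat => (nat => 'a option)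
  with w = s 0 and sigma_j = s (Suc j).\<close>
type_synonym 'a seqfun = "nat \<Rightarrow> (nat \<Rightarrow> 'a option)"

definition is_condQ :: "(nat \<Rightarrow> nat) \<Rightarrow> (nat \<Rightarrow> nat) \<Rightarrow> (nat \<Rightarrow> 'a set) \<Rightarrow> 'a seqfun \<Rightarrow> bool" where
  "is_condQ n0 n1 H p \<longleftrightarrow>
     (\<forall>k. p k \<in> finfuns H) \<and>
     (\<forall>k l. k \<noteq> l \<longrightarrow> dom (p k) \<inter> dom (p l) = {}) \<and>
     (\<exists>mstar::nat. \<exists>V :: nat \<Rightarrow> nat set.
        (\<forall>m1 m2. mstar \<le> m1 \<longrightarrow> mstar \<le> m2 \<longrightarrow> m1 \<noteq> m2 \<longrightarrow> V m1 \<inter> V m2 = {}) \<and>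
        (\<Union>m\<in>{mstar..}. V m) = UNIV \<and>
        (\<forall>m\<ge>mstar. finite (V m) \<and> card (V m) \<le> n1 m * 2 ^ mstar \<and>
           (\<forall>j\<in>V m. real (card (dom (p (Suc j)))) \<ge> real (n0 m) / 2 ^ mstar)))"

definition QH :: "(nat \<Rightarrow> nat) \<Rightarrow> (nat \<Rightarrow> nat) \<Rightarrow> (nat \<Rightarrow> 'a set) \<Rightarrow> 'a seqfun set" where
  "QH n0 n1 H = {p. is_condQ n0 n1 H p}"

definition POS :: "(nat \<Rightarrow> 'a set) \<Rightarrow> 'a seqfun \<Rightarrow> (nat \<Rightarrow> 'a) set" where
  "POS H p = {\<eta>. (\<forall>i. \<eta> i \<in> H i) \<and> p 0 \<subseteq>\<^sub>m (Some \<circ> \<eta>) \<and>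
                   (\<forall>j. \<not> (p (Suc j) \<subseteq>\<^sub>m (Some \<circ> \<eta>)))}"

definition leQ :: "(nat \<Rightarrow> 'a set) \<Rightarrow> 'a seqfun \<Rightarrow> 'a seqfun \<Rightarrow> bool" where
  "leQ H p q \<longleftrightarrow> POS H q \<subseteq> POS H p"

section \<open>General notions for a forcing notion (P, le), le p q meaning q is stronger\<close>

definition compatible_in :: "'c set \<Rightarrow> ('c \<Rightarrow> 'c \<Rightarrow> bool) \<Rightarrow> 'c \<Rightarrow> 'c \<Rightarrow> bool" where
  "compatible_in P le p q \<longleftrightarrow> (\<exists>r\<in>P. le p r \<and> le q r)"

definition sigma_star_linked :: "'c set \<Rightarrow> ('c \<Rightarrow> 'c \<Rightarrow> bool) \<Rightarrow> bool" where
  "sigma_star_linked P le \<longleftrightarrow>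
     (\<forall>n::nat. \<exists>A :: nat \<Rightarrow> 'c set.
        (\<forall>i j. i \<noteq> j \<longrightarrow> A i \<inter> A j = {}) \<and> (\<Union>i. A i) = P \<and>
        (\<forall>i. \<forall>q :: nat \<Rightarrow> 'c. (\<forall>k\<le>n. q k \<in> A i) \<longrightarrow> (\<exists>r\<in>P. \<forall>k\<le>n. le (q k) r)))"

definition ccc :: "'c set \<Rightarrow> ('c \<Rightarrow> 'c \<Rightarrow> bool) \<Rightarrow> bool" where
  "ccc P le \<longleftrightarrow> (\<forall>B\<subseteq>P. (\<forall>p\<in>B. \<forall>q\<in>B. p \<noteq> q \<longrightarrow> \<not> compatible_in P le p q) \<longrightarrow> countable B)"

definition baire_space :: "(nat \<Rightarrow> nat) topology" where
  "baire_space = product_topology (\<lambda>_. discrete_topology (UNIV :: nat set)) UNIV"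

definition sigma11_in :: "'b topology \<Rightarrow> 'b set \<Rightarrow> bool" where
  "sigma11_in X A \<longleftrightarrow> (\<exists>C. closedin (prod_topology X baire_space) C \<and> A = fst ` C)"

definition cond_space :: "(nat \<Rightarrow> 'a set) \<Rightarrow> 'a seqfun topology" where
  "cond_space H = product_topology (\<lambda>_. discrete_topology (finfuns H)) UNIV"

definition souslin :: "'b topology \<Rightarrow> 'b set \<Rightarrow> ('b \<Rightarrow> 'b \<Rightarrow> bool) \<Rightarrow> bool" where
  "souslin X P le \<longleftrightarrow>
     P \<subseteq> topspace X \<and>
     sigma11_in X P \<and>
     sigma11_in (prod_topology X X) {(p, q). p \<in> P \<and> q \<in> P \<and> le p q} \<and>
     sigma11_in (prod_topology X X) {(p, q). p \<in> P \<and> q \<in> P \<and> \<not> compatible_in P le p q}"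

definition souslin_ccc :: "'b topology \<Rightarrow> 'b set \<Rightarrow> ('b \<Rightarrow> 'b \<Rightarrow> bool) \<Rightarrow> bool" where
  "souslin_ccc X P le \<longleftrightarrow> souslin X P le \<and> ccc P le"

end

theory Submission
  imports Defs
begin

text \<open>
  Everything rests on amalgamating finitely many conditions. Call \<open>m\<close> the level of \<open>\<sigma>\<^sub>j\<close> if
  \<open>j \<in> V\<^sub>m\<close>. Given \<open>N\<close> conditions and \<open>\<eta>\<close> that extends all the \<open>w\<close> and avoids all the \<open>\<sigma>\<^sub>j\<close> of level
  below a large \<open>M\<close>, freeze \<open>\<eta>\<close> on the domains of the \<open>w\<close> and at one witness of disagreement for each
  low \<open>\<sigma>\<^sub>j\<close>. The domains of the remaining \<open>\<sigma>\<^sub>j\<close> overlap at most \<open>N\<close>-fold, so on each level Hall's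
  theorem shrinks them to disjoint sets about \<open>1/N\<close> as large; the points consumed by the frozen part and
  by lower levels are negligible because \<open>n0 m\<close> dominates the sum of the earlier \<open>n0 l * n1 l\<close>. The
  result is a common upper bound.

  Linkedness follows since \<open>w\<close> and the low \<open>\<sigma>\<^sub>j\<close> are countably many data. Moreover, conditions are
  compatible as soon as every finite part of the requirements on \<open>\<eta>\<close> can be met, so incompatibility
  becomes a countable union of clopen relations; the order relation has a similar description.
\<close>

section \<open>Disjoint selections\<close>

text \<open>Hall's marriage theorem, by induction on the total size of the sets. If all of them are
  singletons, the condition for pairs of indices makes their elements distinct; otherwise some set
  can lose an element.\<close>

lemma hall_selection:
  fixes B :: "'x \<Rightarrow> 'p set"
  assumes "finite I" and "\<And>x. x \<in> I \<Longrightarrow> finite (B x)"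
    and "\<And>J. J \<subseteq> I \<Longrightarrow> card J \<le> card (\<Union>(B ` J))"
  shows "\<exists>f. inj_on f I \<and> (\<forall>x\<in>I. f x \<in> B x)"
  using assms(2,3)
proof (induction "\<Sum>x\<in>I. card (B x)" arbitrary: B rule: less_induct)
  case (less B)
  note finB = less.prems(1) and hall = less.prems(2)
  show ?case
  proof (cases "\<exists>x\<in>I. \<exists>a\<in>B x. \<exists>b\<in>B x. a \<noteq> b")
    case False
    have ne: "B x \<noteq> {}" if "x \<in> I" for x
      using hall[of "{x}"] that by auto
    have "\<exists>a. B x = {a}" if "x \<in> I" for x
      using False ne[OF that] that by (metis is_singletonI' is_singleton_def)
    then obtain f where f: "\<And>x. x \<in> I \<Longrightarrow> B x = {f x}"
      by metis
    have "f x \<noteq> f y" if "x \<in> I" "y \<in> I" "x \<noteq> y" for x y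
      using hall[of "{x,y}"] that f by auto
    then show ?thesis
      using f by (intro exI[of _ f]) (auto simp: inj_on_def)
  next
    case True
    \<comment> \<open>Rado's argument: one of two elements of a set can be removed without violating Hall's condition.\<close>
    then obtain x a b where x: "x \<in> I" and ab: "a \<in> B x" "b \<in> B x" "a \<noteq> b"
      by blast
    define R where "R c = B(x := B x - {c})" for c
    define good where "good c \<longleftrightarrow> (\<forall>J\<subseteq>I. card J \<le> card (\<Union>(R c ` J)))" for c
    have finR: "finite (R c y)" if "y \<in> I" for c y
      using finB that by (auto simp: R_def)
    have mem: "x \<in> J" if "J \<subseteq> I" "\<not> card J \<le> card (\<Union>(R c ` J))" for J c
    proof (rule ccontr)
      assume "x \<notin> J"
      then have "R c ` J = B ` J"
        by (auto simp: R_def)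
      with that hall[of J] show False by simp
    qed
    have "good a \<or> good b"
    proof (rule ccontr)
      assume "\<not> (good a \<or> good b)"
      then obtain J1 J2 where J1: "J1 \<subseteq> I" "\<not> card J1 \<le> card (\<Union>(R a ` J1))"
        and J2: "J2 \<subseteq> I" "\<not> card J2 \<le> card (\<Union>(R b ` J2))"
        unfolding good_def by blast
      have xJ: "x \<in> J1" "x \<in> J2"
        using mem J1 J2 by blast+
      define X1 X2 where "X1 = \<Union>(R a ` J1)" and "X2 = \<Union>(R b ` J2)"
      have finJ: "finite J1" "finite J2"
        using J1 J2 assms(1) finite_subset by blast+
      have finX: "finite X1" "finite X2"
        using J1 J2 finJ finR by (auto simp: X1_def X2_def)
      \<comment> \<open>Both \<open>J1\<close> and \<open>J2\<close> contain \<open>x\<close>, and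
        \<open>a \<noteq> b\<close>, so the two thinned families together recover all of
        \<open>B x\<close>. Removing \<open>x\<close> from \<open>J1 \<inter> J2\<close> costs one,
        hence \<open>card X1 + card X2 \<ge> card J1 + card J2 - 1\<close>, whereas the two
        violations give at most \<open>card J1 + card J2 - 2\<close>.\<close>
      have "\<Union>(B ` (J1 \<union> J2)) \<subseteq> X1 \<union> X2"
        using xJ ab unfolding X1_def X2_def R_def by fastforce
      then have "card (J1 \<union> J2) \<le> card (X1 \<union> X2)"
        using hall[of "J1 \<union> J2"] J1(1) J2(1) finX
        by (meson card_mono finite_UnI le_trans le_supI)
      moreover have "\<Union>(B ` (J1 \<inter> J2 - {x})) \<subseteq> X1 \<inter> X2"
        unfolding X1_def X2_def R_def by fastforce
      then have "card (J1 \<inter> J2 - {x}) \<le> card (X1 \<inter> X2)"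
        using hall[of "J1 \<inter> J2 - {x}"] J1(1) finX
        by (meson card_mono finite_Int le_trans Diff_subset inf.coboundedI1 subset_trans)
      moreover have "card (J1 \<inter> J2) = Suc (card (J1 \<inter> J2 - {x}))"
        using xJ finJ by (metis IntI card_Suc_Diff1 finite_Int)
      ultimately show False
        using card_Un_Int[of J1 J2] card_Un_Int[of X1 X2] finJ finX J1(2) J2(2)
        by (simp add: X1_def X2_def)
    qed
    then obtain c where c: "c \<in> B x" "good c"
      using ab by blast
    have "(\<Sum>y\<in>I. card (R c y)) < (\<Sum>y\<in>I. card (B y))"
    proof (rule sum_strict_mono_ex1)
      show "\<forall>y\<in>I. card (R c y) \<le> card (B y)"
        using finB by (auto simp: R_def intro!: card_mono)
      show "\<exists>y\<in>I. card (R c y) < card (B y)"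
        using x card_Diff1_less[OF finB[OF x] c(1)] by (intro bexI[of _ x]) (simp_all add: R_def)
    qed (rule assms(1))
    from less.hyps[OF this finR] c(2)
    obtain f where "inj_on f I" "\<forall>y\<in>I. f y \<in> R c y"
      unfolding good_def by blast
    then show ?thesis
      by (intro exI[of _ f]) (auto simp: R_def split: if_splits)
  qed
qed

text \<open>Double counting of the pairs \<open>(x, i)\<close> with
  \<open>i \<in> B x\<close>.\<close>

lemma card_Union_ge_if_bounded_multiplicity:
  assumes "finite J" and "\<And>x. x \<in> J \<Longrightarrow> finite (B x)"
    and "\<And>i. card {x\<in>J. i \<in> B x} \<le> N"
  shows "(\<Sum>x\<in>J. card (B x)) \<le> N * card (\<Union>(B ` J))"
proof -
  let ?U = "\<Union>(B ` J)"
  have finU: "finite ?U"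
    using assms by auto
  have "(\<Sum>x\<in>J. card (B x)) = (\<Sum>x\<in>J. \<Sum>i\<in>?U. if i \<in> B x then 1 else 0)"
  proof (rule sum.cong)
    fix x assume "x \<in> J"
    then have "?U \<inter> {i. i \<in> B x} = B x" by auto
    then show "card (B x) = (\<Sum>i\<in>?U. if i \<in> B x then 1 else 0)"
      using finU by (simp add: sum.If_cases)
  qed simp
  also have "\<dots> = (\<Sum>i\<in>?U. \<Sum>x\<in>J. if i \<in> B x then 1 else 0)"
    by (rule sum.swap)
  also have "\<dots> = (\<Sum>i\<in>?U. card {x\<in>J. i \<in> B x})"
    using assms(1) by (simp add: sum.If_cases Int_def)
  also have "\<dots> \<le> (\<Sum>i\<in>?U. N)"
    by (intro sum_mono assms(3))
  finally show ?thesis by (simp add: mult.commute)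
qed

text \<open>Hall's condition is a matter of counting: sets of size at least \<open>N * e\<close>
  that overlap at most \<open>N\<close>-fold cover at least \<open>e\<close> points per set.\<close>

lemma disjoint_selection:
  fixes B :: "'x \<Rightarrow> 'p set"
  assumes "finite I" and "\<And>x. x \<in> I \<Longrightarrow> finite (B x)" and "0 < N"
    and big: "\<And>x. x \<in> I \<Longrightarrow> N * e \<le> card (B x)"
    and mult: "\<And>i. card {x\<in>I. i \<in> B x} \<le> N"
  shows "\<exists>E. (\<forall>x\<in>I. E x \<subseteq> B x \<and> card (E x) = e) \<and>
             (\<forall>x\<in>I. \<forall>y\<in>I. x \<noteq> y \<longrightarrow> E x \<inter> E y = {})"
proof -
  \<comment> \<open>Hall's theorem for \<open>e\<close> copies of every set\<close>
  have "\<exists>f. inj_on f (I \<times> {..<e}) \<and> (\<forall>z\<in>I \<times> {..<e}. f z \<in> B (fst z))"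
  proof (rule hall_selection)
    fix J assume J: "J \<subseteq> I \<times> {..<e}"
    define J' where "J' = fst ` J"
    have J'I: "J' \<subseteq> I"
      using J by (auto simp: J'_def)
    with assms(1) have finJ': "finite J'"
      by (rule rev_finite_subset)
    have "J \<subseteq> J' \<times> {..<e}"
      using J by (force simp: J'_def)
    then have "card J \<le> card (J' \<times> {..<e})"
      using finJ' by (intro card_mono) auto
    then have "N * card J \<le> N * (card J' * e)"
      by (simp add: card_cartesian_product)
    also have "\<dots> = (\<Sum>x\<in>J'. N * e)" by simp
    also have "\<dots> \<le> (\<Sum>x\<in>J'. card (B x))"
      using big J'I by (intro sum_mono) auto
    also have "\<dots> \<le> N * card (\<Union>(B ` J'))"
    proof (rule card_Union_ge_if_bounded_multiplicity)
      show "card {x\<in>J'. i \<in> B x} \<le> N" for i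
        using J'I assms(1) by (intro order_trans[OF card_mono mult[of i]]) auto
    qed (use finJ' J'I assms(2) in auto)
    also have "\<Union>(B ` J') = (\<Union>z\<in>J. B (fst z))"
      by (auto simp: J'_def)
    finally show "card J \<le> card (\<Union>z\<in>J. B (fst z))"
      using \<open>0 < N\<close> by simp
  qed (use assms in auto)
  then obtain f where inj: "inj_on f (I \<times> {..<e})" and f: "\<And>x k. x \<in> I \<Longrightarrow> k < e \<Longrightarrow> f (x,k) \<in> B x"
    by force
  define E where "E x = (\<lambda>k. f (x,k)) ` {..<e}" for x
  have "card (E x) = e" if "x \<in> I" for x
    using that inj unfolding E_def by (subst card_image) (auto simp: inj_on_def)
  moreover have "E x \<inter> E y = {}" if "x \<in> I" "y \<in> I" "x \<noteq> y" for x y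
    using that inj unfolding E_def inj_on_def by blast
  ultimately show ?thesis
    using f by (intro exI[of _ E]) (auto simp: E_def)
qed

text \<open>The arithmetic of one level: \<open>k\<close> stands for \<open>n0 m\<close>,
  \<open>a\<close> for the size of a domain, \<open>u\<close> for the number of points already
  consumed, \<open>S\<close> for the sum of the earlier \<open>n0 l * n1 l\<close>. After
  multiplication by \<open>K\<close>, the demand \<open>N * (k div 2 ^ M + 1)\<close> costs at most
  a little more than \<open>k / 4\<close> and \<open>u\<close> costs less than
  \<open>k / 256\<close>; together they stay below \<open>k \<le> K * a\<close>.\<close>

lemma level_room:
  fixes N K M m a u S k :: nat
  assumes "0 < N" "0 < K" "4 * N * K \<le> 2 ^ M" "M \<le> m" "0 < S"
    and "2 ^ (2 * (m + 2)) * S < k" and "k \<le> K * a" and "u \<le> K * S"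
  shows "N * (k div 2 ^ M + 1) + u \<le> a"
proof -
  define P :: nat where "P = 2 ^ M"
  define e where "e = k div P + 1"
  have "P * (k div P) \<le> k" by simp
  then have 1: "P * e \<le> k + P"
    by (simp add: e_def)
  have "4 * N * K * e \<le> P * e"
    unfolding P_def by (rule mult_le_mono1[OF assms(3)])
  also note 1
  finally have 2: "4 * (K * (N * e)) \<le> k + P"
    by (simp add: ac_simps)
  have "4 * K \<le> P"
  proof -
    have "1 * (4 * K) \<le> N * (4 * K)" using assms(1) by (intro mult_le_mono1) simp
    also have "\<dots> \<le> P" using assms(3) by (simp add: P_def ac_simps)
    finally show ?thesis by simp
  qed
  then have "(4 * K) * (4 * K) * S \<le> P * P * S"
    by (intro mult_le_mono) auto
  then have 3: "16 * (K * (K * S)) \<le> P * P * S" by simp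
  have "16 * (P * P) = 2 ^ (2 * (M + 2))"
    by (simp add: P_def power_add mult_2)
  also have "\<dots> \<le> 2 ^ (2 * (m + 2))"
    using assms(4) by simp
  finally have "16 * (P * P) * S \<le> 2 ^ (2 * (m + 2)) * S"
    by (rule mult_le_mono1)
  also note assms(6)
  finally have 4: "16 * (P * P * S) < k" by (simp only: mult.assoc)
  have "P * 1 \<le> P * (P * S)"
    using assms(5) by (intro mult_le_mono) (auto simp: P_def)
  then have 5: "P \<le> P * P * S" by simp
  have "K * u \<le> K * (K * S)" using assms(8) by simp
  then have "K * (N * e) + K * u \<le> k"
    using 2 3 4 5 by linarith
  then have "K * (N * e + u) \<le> K * a"
    using assms(7) by (simp add: distrib_left)
  then show ?thesis
    using assms(2) by (simp add: e_def P_def)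
qed

text \<open>Greedy recursion over the levels. At level \<open>m\<close> the points of
  \<open>D\<close> and those used on lower levels number at most \<open>K\<close> times the sum of
  the earlier \<open>n0 l * n1 l\<close>, so by \<open>level_room\<close> each \<open>A x\<close>
  keeps enough points for \<open>disjoint_selection\<close>.\<close>

lemma level_selection:
  fixes n0 n1 :: "nat \<Rightarrow> nat" and X :: "'x set" and lev :: "'x \<Rightarrow> nat" and A :: "'x \<Rightarrow> nat set"
  assumes N: "in_N n0 n1" and "0 < N" "0 < K" "4 * N * K \<le> 2 ^ M"
    and lev: "\<And>x. x \<in> X \<Longrightarrow> M \<le> lev x"
    and fin: "\<And>m. finite {x\<in>X. lev x = m}"
    and card_le: "\<And>m. card {x\<in>X. lev x = m} \<le> K * n1 m"
    and finA: "\<And>x. x \<in> X \<Longrightarrow> finite (A x)"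
    and big: "\<And>x. x \<in> X \<Longrightarrow> n0 (lev x) \<le> K * card (A x)"
    and mult: "\<And>i m. card {x\<in>X. lev x = m \<and> i \<in> A x} \<le> N"
    and D: "finite D" "card D \<le> K * (\<Sum>m<M. n0 m * n1 m)"
  shows "\<exists>E. (\<forall>x\<in>X. E x \<subseteq> A x - D \<and> n0 (lev x) \<le> 2 ^ M * card (E x)) \<and>
             (\<forall>x\<in>X. \<forall>y\<in>X. x \<noteq> y \<longrightarrow> E x \<inter> E y = {})"
proof -
  define S where "S m = (\<Sum>l<m. n0 l * n1 l)" for m
  \<comment> \<open>Adding 1 after the division ensures \<open>n0 m \<le> 2 ^ M * e m\<close>; since
    \<open>2 ^ M\<close> is at least 2, \<open>e m\<close> still does not exceed
    \<open>n0 m\<close>.\<close>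
  define e where "e m = n0 m div 2 ^ M + 1" for m
  define L where "L m = {x\<in>X. lev x = m}" for m
  define good where "good m U E \<longleftrightarrow> (\<forall>x\<in>L m. E x \<subseteq> A x - U \<and> card (E x) = e m) \<and>
      (\<forall>x\<in>L m. \<forall>y\<in>L m. x \<noteq> y \<longrightarrow> E x \<inter> E y = {})" for m U E
  define pick where "pick m U = (SOME E. good m U E)" for m U
  \<comment> \<open>\<open>U k\<close>: the points of \<open>D\<close> and those used on the levels \<open>M, \<dots>, M + k - 1\<close>\<close>
  define U where "U = rec_nat D (\<lambda>k U. U \<union> \<Union>(pick (M + k) U ` L (M + k)))"
  have U0: "U 0 = D" and USuc: "U (Suc k) = U k \<union> \<Union>(pick (M + k) (U k) ` L (M + k))" for k
    by (simp_all add: U_def)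
  have pos: "4 < n0 m" "n0 m \<le> n1 m" "2 ^ (2 * (m + 2)) * S m < n0 m" for m
    using N unfolding in_N_def S_def by auto
  \<comment> \<open>This forces \<open>M\<close> to be positive, so from level \<open>M\<close> on
    the sum \<open>S m\<close> is nonempty, as \<open>level_room\<close> demands.\<close>
  have "1 < (2::nat) ^ M"
  proof -
    have "0 < N * K" using assms(2,3) by simp
    then show ?thesis using assms(4) by linarith
  qed
  then have "0 < M" by (cases M) auto
  have Spos: "0 < S m" if "M \<le> m" for m
  proof -
    have "n0 0 * n1 0 \<le> S m"
      unfolding S_def using that \<open>0 < M\<close> by (intro member_le_sum) auto
    moreover have "0 < n0 0 * n1 0"
      using pos(1,2)[of 0] by simp
    ultimately show ?thesis by linarith
  qed
  have e_le: "e m \<le> n0 m" for m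
  proof -
    have "n0 m div 2 ^ M \<le> n0 m div 2"
      using \<open>1 < 2 ^ M\<close> by (intro div_le_mono2) auto
    then show ?thesis unfolding e_def using pos(1)[of m] by linarith
  qed
  have ex: "good m V (pick m V)"
    if m: "M \<le> m" and V: "finite V" "card V \<le> K * S m" for m V
  proof -
    have "\<exists>E. (\<forall>x\<in>L m. E x \<subseteq> A x - V \<and> card (E x) = e m) \<and>
      (\<forall>x\<in>L m. \<forall>y\<in>L m. x \<noteq> y \<longrightarrow> E x \<inter> E y = {})"
    proof (rule disjoint_selection)
      show "finite (L m)" using fin by (simp add: L_def)
      show "finite (A x - V)" if "x \<in> L m" for x
        using that finA by (auto simp: L_def)
      show "N * e m \<le> card (A x - V)" if "x \<in> L m" for x
      proof -
        have "N * e m + card V \<le> card (A x)"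
          unfolding e_def
          using level_room[OF assms(2-4) m Spos[OF m] pos(3)] big[of x] that V(2)
          by (auto simp: L_def)
        then show ?thesis
          using diff_card_le_card_Diff[OF V(1), of "A x"] by linarith
      qed
      show "card {x \<in> L m. i \<in> A x - V} \<le> N" for i
        by (rule order_trans[OF card_mono mult[of m i]], rule finite_subset[OF _ fin[of m]])
          (auto simp: L_def)
    qed (rule \<open>0 < N\<close>)
    then show ?thesis
      unfolding pick_def good_def by (rule someI_ex)
  qed
  \<comment> \<open>Level \<open>M + k\<close> consumes at most \<open>K * n1 (M + k)\<close> sets
    of at most \<open>n0 (M + k)\<close> points each, which is \<open>K\<close> times the new
    summand of \<open>S\<close>.\<close>
  have inv: "finite (U k) \<and> card (U k) \<le> K * S (M + k)" for k
  proof (induction k)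
    case 0
    then show ?case using D by (simp add: U0 S_def)
  next
    case (Suc k)
    then have g: "good (M + k) (U k) (pick (M + k) (U k))" (is "good _ _ ?E")
      by (intro ex) auto
    have finE: "finite (?E x)" if "x \<in> L (M + k)" for x
    proof (rule finite_subset)
      show "?E x \<subseteq> A x" using g that by (auto simp: good_def)
      show "finite (A x)" using that finA by (auto simp: L_def)
    qed
    have finL: "finite (L (M + k))" using fin by (simp add: L_def)
    have "card (\<Union>(?E ` L (M + k))) \<le> (\<Sum>x\<in>L (M + k). card (?E x))"
      by (rule card_UN_le[OF finL])
    also have "\<dots> = card (L (M + k)) * e (M + k)"
      using g by (simp add: good_def)
    also have "\<dots> \<le> (K * n1 (M + k)) * n0 (M + k)"
      using card_le e_le unfolding L_def by (intro mult_le_mono) auto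
    finally have "card (U (Suc k)) \<le> card (U k) + K * n1 (M + k) * n0 (M + k)"
      unfolding USuc using card_Un_le by (meson add_left_mono le_trans)
    with Suc have "card (U (Suc k)) \<le> K * S (M + Suc k)"
      by (simp add: S_def algebra_simps)
    with Suc finE finL show ?case by (auto simp: USuc)
  qed
  have g: "good (M + k) (U k) (pick (M + k) (U k))" for k
    using inv by (intro ex) auto
  have Umono: "k \<le> k' \<Longrightarrow> U k \<subseteq> U k'" for k k'
    by (rule lift_Suc_mono_le) (auto simp: USuc)
  define E where "E x = pick (lev x) (U (lev x - M)) x" for x
  have gx: "good (lev x) (U (lev x - M)) (pick (lev x) (U (lev x - M)))" if "x \<in> X" for x
    using g[of "lev x - M"] lev[OF that] by simp
  have EA: "E x \<subseteq> A x - U (lev x - M)" "card (E x) = e (lev x)" if "x \<in> X" for x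
    using gx[OF that] that by (auto simp: good_def L_def E_def)
  have EU: "E x \<subseteq> U (Suc (lev x - M))" if "x \<in> X" for x
    using that lev[OF that] by (auto simp: E_def USuc L_def)
  have less: "E x \<inter> E y = {}" if "x \<in> X" "y \<in> X" "lev x < lev y" for x y
  proof -
    have "U (Suc (lev x - M)) \<subseteq> U (lev y - M)"
      using that lev[OF that(1)] by (intro Umono) auto
    then show ?thesis using EA(1)[OF that(2)] EU[OF that(1)] by blast
  qed
  have eq: "E x \<inter> E y = {}" if "x \<in> X" "y \<in> X" "lev x = lev y" "x \<noteq> y" for x y
    using gx[OF that(1)] that unfolding good_def E_def L_def by auto
  have "E x \<inter> E y = {}" if "x \<in> X" "y \<in> X" "x \<noteq> y" for x y
    using less[OF that(1,2)] less[OF that(2,1)] eq[OF that(1,2) _ that(3)]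
    by (metis Int_commute linorder_neqE_nat)
  moreover have "E x \<subseteq> A x - D" if "x \<in> X" for x
    using EA(1)[OF that] Umono[of 0 "lev x - M"] U0 by auto
  moreover have "n0 (lev x) \<le> 2 ^ M * card (E x)" if "x \<in> X" for x
    using dividend_less_times_div[of "2 ^ M" "n0 (lev x)"] by (simp add: EA(2)[OF that] e_def)
  ultimately show ?thesis by (intro exI[of _ E]) simp
qed

section \<open>Conditions and their common upper bounds\<close>

text \<open>The partition of the paper is encoded by the function \<open>l\<close> sending \<open>j\<close> to the index \<open>m\<close> with
  \<open>j \<in> V\<^sub>m\<close>; \<open>s\<close> is \<open>m\<^sup>*\<close>.\<close>
definition leveled :: "(nat \<Rightarrow> nat) \<Rightarrow> (nat \<Rightarrow> nat) \<Rightarrow> 'a seqfun \<Rightarrow> nat \<Rightarrow> (nat \<Rightarrow> nat) \<Rightarrow> bool" where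
  "leveled n0 n1 p s l \<longleftrightarrow>
     (\<forall>j. s \<le> l j) \<and> (\<forall>m. finite {j. l j = m} \<and> card {j. l j = m} \<le> n1 m * 2 ^ s) \<and>
     (\<forall>j. n0 (l j) \<le> 2 ^ s * card (dom (p (Suc j))))"

lemma real_div_power_le_iff: "real a / 2 ^ s \<le> real b \<longleftrightarrow> a \<le> 2 ^ s * b"
proof -
  have "real a / 2 ^ s \<le> real b \<longleftrightarrow> real a \<le> real (2 ^ s * b)"
    by (simp add: field_simps)
  then show ?thesis by (simp only: of_nat_le_iff)
qed

text \<open>From a partition, \<open>l j\<close> is chosen as some \<open>m \<ge> s\<close> with
  \<open>j \<in> V m\<close>; from \<open>l\<close>, the blocks are its fibres. Clearing
  denominators removes the real numbers.\<close>

lemma QH_iff: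
  "p \<in> QH n0 n1 H \<longleftrightarrow> (\<forall>k. p k \<in> finfuns H) \<and>
     (\<forall>k l. k \<noteq> l \<longrightarrow> dom (p k) \<inter> dom (p l) = {}) \<and> (\<exists>s l. leveled n0 n1 p s l)"
proof -
  have "(\<exists>V :: nat \<Rightarrow> nat set.
        (\<forall>m1 m2. s \<le> m1 \<longrightarrow> s \<le> m2 \<longrightarrow> m1 \<noteq> m2 \<longrightarrow> V m1 \<inter> V m2 = {}) \<and>
        (\<Union>m\<in>{s..}. V m) = UNIV \<and>
        (\<forall>m\<ge>s. finite (V m) \<and> card (V m) \<le> n1 m * 2 ^ s \<and>
           (\<forall>j\<in>V m. real (card (dom (p (Suc j)))) \<ge> real (n0 m) / 2 ^ s)))
     \<longleftrightarrow> (\<exists>l. leveled n0 n1 p s l)" (is "?L \<longleftrightarrow> ?R") for s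
  proof
    assume ?L
    then obtain V where V0: "(\<forall>m1 m2. s \<le> m1 \<longrightarrow> s \<le> m2 \<longrightarrow> m1 \<noteq> m2 \<longrightarrow> V m1 \<inter> V m2 = {}) \<and>
        (\<Union>m\<in>{s..}. V m) = UNIV \<and>
        (\<forall>m\<ge>s. finite (V m) \<and> card (V m) \<le> n1 m * 2 ^ s \<and>
           (\<forall>j\<in>V m. real (card (dom (p (Suc j)))) \<ge> real (n0 m) / 2 ^ s))" ..
    have V: "(\<Union>m\<in>{s..}. V m) = UNIV"
      "\<And>m. s \<le> m \<Longrightarrow> finite (V m) \<and> card (V m) \<le> n1 m * 2 ^ s"
      "\<And>m j. s \<le> m \<Longrightarrow> j \<in> V m \<Longrightarrow> n0 m \<le> 2 ^ s * card (dom (p (Suc j)))"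
      using V0 by (simp_all add: real_div_power_le_iff)
    have "\<exists>m\<ge>s. j \<in> V m" for j
      using V(1) by auto
    then obtain l where l: "\<And>j. s \<le> l j" "\<And>j. j \<in> V (l j)"
      by metis
    \<comment> \<open>\<open>leveled\<close> constrains the fibres over every \<open>m\<close>;
      those below \<open>s\<close> are empty.\<close>
    have "finite {j. l j = m} \<and> card {j. l j = m} \<le> n1 m * 2 ^ s" for m
    proof (cases "s \<le> m")
      case True
      have "{j. l j = m} \<subseteq> V m" using l(2) by auto
      then show ?thesis
        using V(2)[OF True] by (meson card_mono finite_subset le_trans)
    next
      case False
      then have "{j. l j = m} = {}" using l(1) by auto
      then show ?thesis by simp
    qed
    then have "leveled n0 n1 p s l"
      using l V(3)[OF l(1) l(2)] by (simp add: leveled_def)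
    then show ?R by blast
  next
    assume ?R
    then obtain l where l: "leveled n0 n1 p s l" ..
    then have "(\<Union>m\<in>{s..}. {j. l j = m}) = UNIV"
      by (auto simp: leveled_def)
    then show ?L
      using l unfolding leveled_def real_div_power_le_iff
      by (intro exI[of _ "\<lambda>m. {j. l j = m}"] conjI) auto
  qed
  then show ?thesis
    unfolding QH_def is_condQ_def by simp
qed

text \<open>The growth condition gives this as soon as its sum is nonempty; for \<open>m = 0\<close>
  the bound \<open>4 < n0 0\<close> takes over.\<close>

lemma in_N_lower:
  assumes "in_N n0 n1"
  shows "2 ^ m < n0 m"
proof (cases m)
  case 0
  then show ?thesis using assms unfolding in_N_def by (metis less_trans numeral_One power_0 one_less_numeral_iff semiring_norm(76))
next
  case (Suc k)
  have "n0 0 * n1 0 \<le> (\<Sum>l<m. n0 l * n1 l)"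
    using Suc by (intro member_le_sum) auto
  moreover have "4 < n0 0" "n0 0 \<le> n1 0"
    using assms unfolding in_N_def by auto
  ultimately have 1: "1 \<le> (\<Sum>l<m. n0 l * n1 l)"
    by (metis le_trans less_one linorder_not_less mult_is_0 not_less_zero le_zero_eq)
  have "2 ^ m * (1::nat) \<le> 2 ^ (2 * (m + 2)) * (\<Sum>l<m. n0 l * n1 l)"
    using 1 by (intro mult_le_mono power_increasing) auto
  also have "\<dots> < n0 m"
    using assms unfolding in_N_def by blast
  finally show ?thesis by simp
qed

text \<open>Levels start at \<open>s\<close>, so \<open>n0 (l j)\<close> exceeds
  \<open>2 ^ s\<close>. Consequently a partial function with at most one point never contains a
  \<open>\<sigma>\<close>, which lets single values be prescribed for points of
  \<open>POS\<close>.\<close>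

lemma leveled_card_ge_2:
  assumes "in_N n0 n1" "leveled n0 n1 p s l"
  shows "2 \<le> card (dom (p (Suc j)))"
proof -
  have "(2::nat) ^ s \<le> 2 ^ l j"
    using assms(2) by (auto simp: leveled_def)
  also have "\<dots> < n0 (l j)" by (rule in_N_lower[OF assms(1)])
  also have "\<dots> \<le> 2 ^ s * card (dom (p (Suc j)))"
    using assms(2) by (auto simp: leveled_def)
  finally show ?thesis by simp
qed

lemma finfuns_restrict: "f \<in> finfuns H \<Longrightarrow> f |` A \<in> finfuns H"
  unfolding finfuns_def dom_restrict mem_Collect_eq by (auto simp: restrict_map_def)

text \<open>Disjointness gives every \<open>x\<close> a coordinate \<open>e x \<in> E x\<close> of
  its own, outside \<open>dom w\<close>. As \<open>H i\<close> has two elements, the value there can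
  be chosen different from that of \<open>\<tau> x\<close>.\<close>

lemma extend_avoiding:
  assumes H: "\<And>i. \<exists>x y. x \<in> H i \<and> y \<in> H i \<and> x \<noteq> y"
    and w: "\<And>i v. w i = Some v \<Longrightarrow> v \<in> H i"
    and E: "\<And>x. x \<in> X \<Longrightarrow> E x \<noteq> {}" "\<And>x. x \<in> X \<Longrightarrow> E x \<subseteq> dom (\<tau> x)"
      "\<And>x. x \<in> X \<Longrightarrow> E x \<inter> dom w = {}"
      "\<And>x y. x \<in> X \<Longrightarrow> y \<in> X \<Longrightarrow> x \<noteq> y \<Longrightarrow> E x \<inter> E y = {}"
  shows "\<exists>\<eta>. (\<forall>i. \<eta> i \<in> H i) \<and> w \<subseteq>\<^sub>m Some \<circ> \<eta> \<and> (\<forall>x\<in>X. \<not> \<tau> x \<subseteq>\<^sub>m Some \<circ> \<eta>)"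
proof -
  have "\<forall>x\<in>X. \<exists>i. i \<in> E x" using E(1) by blast
  then obtain e where e: "\<And>x. x \<in> X \<Longrightarrow> e x \<in> E x" by metis
  have uniq: "x = y" if "x \<in> X" "y \<in> X" "e x = e y" for x y
    using E(4) e that by (metis IntI empty_iff)
  have "\<exists>v. v \<in> H i \<and> (\<forall>x\<in>X. e x = i \<longrightarrow> \<tau> x i \<noteq> Some v)" for i
  proof -
    obtain a b where ab: "a \<in> H i" "b \<in> H i" "a \<noteq> b" using H by blast
    show ?thesis
    proof (cases "\<exists>x\<in>X. e x = i \<and> \<tau> x i = Some a")
      case True
      then show ?thesis using uniq ab by (intro exI[of _ b]) force
    qed (use ab in auto)
  qed
  then obtain h where h: "\<And>i. h i \<in> H i" "\<And>x. x \<in> X \<Longrightarrow> \<tau> x (e x) \<noteq> Some (h (e x))"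
    by metis
  define \<eta> where "\<eta> i = (case w i of Some v \<Rightarrow> v | None \<Rightarrow> h i)" for i
  have "\<eta> i \<in> H i" for i
    using w h(1) by (auto simp: \<eta>_def split: option.split)
  moreover have "w \<subseteq>\<^sub>m Some \<circ> \<eta>"
    by (auto simp: map_le_def \<eta>_def)
  moreover have "\<not> \<tau> x \<subseteq>\<^sub>m Some \<circ> \<eta>" if "x \<in> X" for x
  proof -
    have "w (e x) = None"
      using E(3)[OF that] e[OF that] by auto
    then have "\<eta> (e x) = h (e x)" by (simp add: \<eta>_def)
    moreover have "e x \<in> dom (\<tau> x)" using E(2) e that by blast
    ultimately show ?thesis
      using h(2)[OF that] by (auto simp: map_le_def intro!: bexI[of _ "e x"])
  qed
  ultimately show ?thesis by blast
qed

section \<open>Points of \<open>POS\<close> and a combinatorial form of the order\<close>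

definition consistent :: "('i \<Rightarrow> 'a option) \<Rightarrow> ('i \<Rightarrow> 'a option) \<Rightarrow> bool" where
  "consistent f g \<longleftrightarrow> (\<forall>i\<in>dom f \<inter> dom g. f i = g i)"

text \<open>A \<open>\<sigma>\<close> whose domain lies inside \<open>dom f\<close> is already
  contradicted by \<open>f\<close>. Every other one has a coordinate outside \<open>dom f\<close>,
  and these remainders are disjoint from each other and from \<open>q 0\<close>, so
  \<open>extend_avoiding\<close> handles them simultaneously.\<close>

lemma POS_extends:
  assumes H: "\<And>i. \<exists>x y. x \<in> H i \<and> y \<in> H i \<and> x \<noteq> y"
    and q: "q \<in> QH n0 n1 H"
    and f: "\<And>i v. f i = Some v \<Longrightarrow> v \<in> H i" "consistent f (q 0)"
      "\<And>j. \<not> q (Suc j) \<subseteq>\<^sub>m f"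
  shows "\<exists>\<eta>\<in>POS H q. f \<subseteq>\<^sub>m Some \<circ> \<eta>"
proof -
  define w where "w = q 0 ++ f"
  define X where "X = {j. \<not> dom (q (Suc j)) \<subseteq> dom f}"
  have disj: "dom (q k) \<inter> dom (q l) = {}" if "k \<noteq> l" for k l
    using q that by (auto simp: QH_iff)
  have q0: "q 0 i = Some v \<Longrightarrow> v \<in> H i" for i v
    using q by (auto simp: QH_iff finfuns_def)
  have "\<exists>\<eta>. (\<forall>i. \<eta> i \<in> H i) \<and> w \<subseteq>\<^sub>m Some \<circ> \<eta> \<and> (\<forall>j\<in>X. \<not> q (Suc j) \<subseteq>\<^sub>m Some \<circ> \<eta>)"
  proof (rule extend_avoiding[OF H, where E = "\<lambda>j. dom (q (Suc j)) - dom f"])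
    show "v \<in> H i" if "w i = Some v" for i v
      using that f(1) q0 by (auto simp: w_def map_add_Some_iff)
    show "(dom (q (Suc x)) - dom f) \<inter> dom w = {}" if "x \<in> X" for x
      using disj[of "Suc x" 0] by (auto simp: w_def)
    show "(dom (q (Suc x)) - dom f) \<inter> (dom (q (Suc y)) - dom f) = {}" if "x \<noteq> y" for x y
      using disj[of "Suc x" "Suc y"] that by auto
  qed (auto simp: X_def)
  then obtain \<eta> where \<eta>: "\<And>i. \<eta> i \<in> H i" "w \<subseteq>\<^sub>m Some \<circ> \<eta>"
    "\<And>j. j \<in> X \<Longrightarrow> \<not> q (Suc j) \<subseteq>\<^sub>m Some \<circ> \<eta>"
    by blast
  have fw: "f \<subseteq>\<^sub>m w" by (simp add: w_def)
  have "q 0 \<subseteq>\<^sub>m w"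
    using f(2) by (force simp: w_def map_le_def consistent_def map_add_def split: option.split)
  then have "q 0 \<subseteq>\<^sub>m Some \<circ> \<eta>" and f\<eta>: "f \<subseteq>\<^sub>m Some \<circ> \<eta>"
    using \<eta>(2) fw map_le_trans by blast+
  moreover have "\<not> q (Suc j) \<subseteq>\<^sub>m Some \<circ> \<eta>" for j
  proof (cases "j \<in> X")
    case False
    show ?thesis
    proof
      assume "q (Suc j) \<subseteq>\<^sub>m Some \<circ> \<eta>"
      then have "q (Suc j) \<subseteq>\<^sub>m f"
        using f\<eta> False unfolding map_le_def X_def by (metis (mono_tags, lifting) mem_Collect_eq subsetD)
      then show False using f(3) by blast
    qed
  qed (rule \<eta>(3))
  ultimately show ?thesis
    using \<eta>(1) by (intro bexI[of _ \<eta>]) (auto simp: POS_def)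
qed

lemma leveled_not_map_le_if_card_dom_le_1:
  assumes "in_N n0 n1" "leveled n0 n1 q s l" "finite (dom f)" "card (dom f) \<le> 1"
  shows "\<not> q (Suc j) \<subseteq>\<^sub>m f"
proof
  assume "q (Suc j) \<subseteq>\<^sub>m f"
  then have "card (dom (q (Suc j))) \<le> card (dom f)"
    using assms(3) by (intro card_mono map_le_implies_dom_le)
  then show False using leveled_card_ge_2[OF assms(1,2), of j] assms(4) by linarith
qed

lemma POS_nonempty:
  assumes "in_N n0 n1" and H: "\<And>i. \<exists>x y. x \<in> H i \<and> y \<in> H i \<and> x \<noteq> y"
    and q: "q \<in> QH n0 n1 H"
  shows "POS H q \<noteq> {}"
proof -
  obtain s l where "leveled n0 n1 q s l" using q by (auto simp: QH_iff)
  then have "\<exists>\<eta>\<in>POS H q. Map.empty \<subseteq>\<^sub>m Some \<circ> \<eta>"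
    using assms(1) by (intro POS_extends[OF H q] leveled_not_map_le_if_card_dom_le_1)
      (auto simp: consistent_def)
  then show ?thesis by blast
qed

text \<open>Replaces the quantifier over all \<open>\<eta>\<close> by one over finite functions and
  indices, which is what the complexity computation needs. From left to right, a failure on the
  right yields by \<open>POS_extends\<close> a point of \<open>POS H q\<close> outside
  \<open>POS H p\<close>: one that violates \<open>p 0\<close>, or one that extends some
  \<open>p (Suc j)\<close>.\<close>

lemma leQ_iff:
  assumes N: "in_N n0 n1" and H: "\<And>i. \<exists>x y. x \<in> H i \<and> y \<in> H i \<and> x \<noteq> y"
    and p: "p \<in> QH n0 n1 H" and q: "q \<in> QH n0 n1 H"
  shows "leQ H p q \<longleftrightarrow> p 0 \<subseteq>\<^sub>m q 0 \<and>
    (\<forall>j. \<exists>i. \<not> consistent (p (Suc j)) (q 0) \<or> q (Suc i) \<subseteq>\<^sub>m p (Suc j))" (is "_ \<longleftrightarrow> ?W \<and> ?S")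
proof
  assume le: "leQ H p q"
  obtain s l where lev: "leveled n0 n1 q s l" using q by (auto simp: QH_iff)
  have ?W
    unfolding map_le_def
  proof (rule ballI, rule ccontr)
    fix i assume i: "i \<in> dom (p 0)" "p 0 i \<noteq> q 0 i"
    then obtain a where a: "p 0 i = Some a" by auto
    \<comment> \<open>A value at \<open>i\<close> that \<open>q 0\<close> permits and
      \<open>p 0\<close> forbids: the value of \<open>q 0\<close> if there is one, otherwise any
      element of \<open>H i\<close> other than \<open>a\<close>.\<close>
    have "\<exists>b. b \<in> H i \<and> b \<noteq> a \<and> (q 0 i = None \<or> q 0 i = Some b)"
    proof (cases "q 0 i")
      case None
      then show ?thesis using H by metis
    next
      case (Some b)
      then have "b \<in> H i" using q by (auto simp: QH_iff finfuns_def)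
      then show ?thesis using Some i a by auto
    qed
    then obtain b where b: "b \<in> H i" "b \<noteq> a" "q 0 i = None \<or> q 0 i = Some b" by blast
    have "\<exists>\<eta>\<in>POS H q. [i \<mapsto> b] \<subseteq>\<^sub>m Some \<circ> \<eta>"
      using b by (intro POS_extends[OF H q] leveled_not_map_le_if_card_dom_le_1[OF N lev])
        (auto simp: consistent_def split: if_splits)
    then obtain \<eta> where "\<eta> \<in> POS H p" "\<eta> i = b"
      using le by (auto simp: leQ_def map_le_def)
    then show False using a b(2) by (force simp: POS_def map_le_def)
  qed
  moreover have ?S
  proof (rule allI, rule ccontr)
    fix j assume j: "\<not> (\<exists>i. \<not> consistent (p (Suc j)) (q 0) \<or> q (Suc i) \<subseteq>\<^sub>m p (Suc j))"
    have "p (Suc j) \<in> finfuns H" using p by (auto simp: QH_iff)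
    then have "\<exists>\<eta>\<in>POS H q. p (Suc j) \<subseteq>\<^sub>m Some \<circ> \<eta>"
      using j by (intro POS_extends[OF H q]) (auto simp: finfuns_def)
    then show False using le by (auto simp: leQ_def POS_def)
  qed
  ultimately show "?W \<and> ?S" ..
next
  assume R: "?W \<and> ?S"
  show "leQ H p q"
    unfolding leQ_def
  proof
    fix \<eta> assume \<eta>: "\<eta> \<in> POS H q"
    then have q0: "q 0 \<subseteq>\<^sub>m Some \<circ> \<eta>" by (simp add: POS_def)
    have "p 0 \<subseteq>\<^sub>m Some \<circ> \<eta>"
      using R q0 map_le_trans by blast
    moreover have "\<not> p (Suc j) \<subseteq>\<^sub>m Some \<circ> \<eta>" for j
    proof
      assume pj: "p (Suc j) \<subseteq>\<^sub>m Some \<circ> \<eta>"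
      then have "consistent (p (Suc j)) (q 0)"
        using q0 by (auto simp: consistent_def map_le_def)
      with R obtain i where "q (Suc i) \<subseteq>\<^sub>m p (Suc j)" by blast
      then have "q (Suc i) \<subseteq>\<^sub>m Some \<circ> \<eta>" using pj map_le_trans by blast
      then show False using \<eta> by (auto simp: POS_def)
    qed
    ultimately show "\<eta> \<in> POS H p" using \<eta> by (auto simp: POS_def)
  qed
qed

text \<open>The amalgamation step. Only the \<open>\<sigma>\<close> of level below \<open>M\<close>
  have to be avoided by \<open>\<eta>\<close>; the higher ones are replaced by restrictions to
  pairwise disjoint sets, and a point that avoids the restriction avoids the original.\<close>

lemma common_upper_bound:
  fixes q :: "nat \<Rightarrow> 'a seqfun"
  assumes N: "in_N n0 n1" "0 < N" and q: "\<And>k. k < N \<Longrightarrow> q k \<in> QH n0 n1 H"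
    and lev: "\<And>k. k < N \<Longrightarrow> leveled n0 n1 (q k) (s k) (l k)"
    and t: "\<And>k. k < N \<Longrightarrow> s k \<le> t" and c: "\<And>k. k < N \<Longrightarrow> card (dom (q k 0)) \<le> c"
    and M: "4 * N * (N * (c + 2 ^ t)) \<le> 2 ^ M"
    and \<eta>: "\<And>i. \<eta> i \<in> H i" "\<And>k. k < N \<Longrightarrow> q k 0 \<subseteq>\<^sub>m Some \<circ> \<eta>"
      "\<And>k j. k < N \<Longrightarrow> l k j < M \<Longrightarrow> \<not> q k (Suc j) \<subseteq>\<^sub>m Some \<circ> \<eta>"
  shows "\<exists>r\<in>QH n0 n1 H. \<forall>k<N. leQ H (q k) r"
proof -
  \<comment> \<open>One constant for three bounds: the number of frozen points (at most
    \<open>c\<close> for each \<open>w\<close>, and one witness for each low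
    \<open>\<sigma>\<close>), the number of \<open>\<sigma>\<close> on a level, and the loss
    \<open>2 ^ t\<close> in the sizes of the domains.\<close>
  define K where "K = N * (c + 2 ^ t)"
  define X where "X = {(k,j). k < N \<and> M \<le> l k j}"
  define lv where "lv = (\<lambda>(k,j). l k j)"
  define A where "A = (\<lambda>(k,j). dom (q k (Suc j)))"
  have finf: "q k i \<in> finfuns H" if "k < N" for k i
    using q[OF that] by (simp add: QH_iff)
  have disj: "dom (q k i) \<inter> dom (q k j) = {}" if "k < N" "i \<noteq> j" for k i j
    using q[OF that(1)] that(2) by (simp add: QH_iff)
  have "0 < K" using N(2) by (simp add: K_def)
  have levfin: "finite {j. l k j = m}" "card {j. l k j = m} \<le> n1 m * 2 ^ t" if "k < N" for k m
  proof -
    show "finite {j. l k j = m}" using lev[OF that] by (auto simp: leveled_def)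
    have "card {j. l k j = m} \<le> n1 m * 2 ^ s k" using lev[OF that] by (auto simp: leveled_def)
    also have "\<dots> \<le> n1 m * 2 ^ t" using t[OF that] by (intro mult_le_mono power_increasing) auto
    finally show "card {j. l k j = m} \<le> n1 m * 2 ^ t" .
  qed
  have low: "finite {j. l k j < m}" "card {j. l k j < m} \<le> (\<Sum>i<m. n1 i) * 2 ^ t" if "k < N" for k m
  proof -
    have eq: "{j. l k j < m} = (\<Union>i\<in>{..<m}. {j. l k j = i})" by auto
    show "finite {j. l k j < m}" unfolding eq using levfin that by auto
    have "card {j. l k j < m} \<le> (\<Sum>i<m. card {j. l k j = i})"
      unfolding eq by (rule card_UN_le) simp
    also have "\<dots> \<le> (\<Sum>i<m. n1 i * 2 ^ t)" using levfin that by (intro sum_mono) auto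
    finally show "card {j. l k j < m} \<le> (\<Sum>i<m. n1 i) * 2 ^ t" by (simp add: sum_distrib_right)
  qed
  define Lw where "Lw = (SIGMA k:{..<N}. {j. l k j < M})"
  have "\<forall>z\<in>Lw. \<exists>i. i \<in> dom (q (fst z) (Suc (snd z))) \<and> q (fst z) (Suc (snd z)) i \<noteq> Some (\<eta> i)"
    using \<eta>(3) unfolding Lw_def map_le_def by fastforce
  then obtain d where d: "\<And>z. z \<in> Lw \<Longrightarrow>
      d z \<in> dom (q (fst z) (Suc (snd z))) \<and> q (fst z) (Suc (snd z)) (d z) \<noteq> Some (\<eta> (d z))"
    by metis
  define D where "D = (\<Union>k\<in>{..<N}. dom (q k 0)) \<union> d ` Lw"
  have finLw: "finite Lw" using low by (auto simp: Lw_def)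
  have finD: "finite D"
    using finLw finf by (auto simp: D_def finfuns_def)
  have "2 ^ 0 < (2::nat) ^ M"
  proof -
    have "0 < N * (N * (c + 2 ^ t))" using N(2) by simp
    moreover have "4 * (N * (N * (c + 2 ^ t))) \<le> 2 ^ M"
      using M by (simp only: mult.assoc)
    ultimately have "1 < (2::nat) ^ M" by linarith
    then show ?thesis by simp
  qed
  then have "0 < M" by (cases M) auto
  define S where "S = (\<Sum>m<M. n0 m * n1 m)"
  have n1S: "(\<Sum>m<M. n1 m) \<le> S"
    unfolding S_def
  proof (rule sum_mono)
    fix m
    have "1 * n1 m \<le> n0 m * n1 m"
      using in_N_lower[OF N(1), of m] by (intro mult_le_mono1) auto
    then show "n1 m \<le> n0 m * n1 m" by simp
  qed
  have S1: "1 \<le> S"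
  proof -
    have "n1 0 \<le> (\<Sum>m<M. n1 m)" using \<open>0 < M\<close> by (intro member_le_sum) auto
    moreover have "4 < n0 0" "n0 0 \<le> n1 0" using N(1) by (auto simp: in_N_def)
    ultimately show ?thesis using n1S by linarith
  qed
  have cardD: "card D \<le> K * S"
  proof -
    have "card (\<Union>k\<in>{..<N}. dom (q k 0)) \<le> (\<Sum>k<N. card (dom (q k 0)))"
      by (rule card_UN_le) simp
    also have "\<dots> \<le> (\<Sum>k<N. c)" using c by (intro sum_mono) auto
    also have "\<dots> \<le> N * c * S" using S1 by simp
    finally have 1: "card (\<Union>k\<in>{..<N}. dom (q k 0)) \<le> N * c * S" .
    have "card (d ` Lw) \<le> card Lw" by (rule card_image_le[OF finLw])
    also have "\<dots> = (\<Sum>k<N. card {j. l k j < M})"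
      unfolding Lw_def using low by simp
    also have "\<dots> \<le> (\<Sum>k<N. S * 2 ^ t)"
      using low(2)[of _ M] n1S by (intro sum_mono) (meson lessThan_iff le_trans mult_le_mono1)
    also have "\<dots> = N * 2 ^ t * S" by simp
    finally have "card D \<le> N * c * S + N * 2 ^ t * S"
      unfolding D_def using 1 card_Un_le[of "\<Union>k\<in>{..<N}. dom (q k 0)" "d ` Lw"] by linarith
    then show ?thesis by (simp add: K_def algebra_simps)
  qed
  have Xlev: "finite {x\<in>X. lv x = m}" "card {x\<in>X. lv x = m} \<le> K * n1 m" for m
  proof -
    have sub: "{x\<in>X. lv x = m} \<subseteq> (SIGMA k:{..<N}. {j. l k j = m})"
      by (auto simp: X_def lv_def)
    have fin: "finite (SIGMA k:{..<N}. {j. l k j = m})"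
      using levfin by auto
    show "finite {x\<in>X. lv x = m}" by (rule finite_subset[OF sub fin])
    have "card {x\<in>X. lv x = m} \<le> card (SIGMA k:{..<N}. {j. l k j = m})"
      by (rule card_mono[OF fin sub])
    also have "\<dots> = (\<Sum>k<N. card {j. l k j = m})" using levfin by simp
    also have "\<dots> \<le> (\<Sum>k<N. n1 m * 2 ^ t)" using levfin by (intro sum_mono) auto
    also have "\<dots> \<le> K * n1 m" by (simp add: K_def algebra_simps)
    finally show "card {x\<in>X. lv x = m} \<le> K * n1 m" .
  qed
  have "\<exists>E. (\<forall>x\<in>X. E x \<subseteq> A x - D \<and> n0 (lv x) \<le> 2 ^ M * card (E x)) \<and>
             (\<forall>x\<in>X. \<forall>y\<in>X. x \<noteq> y \<longrightarrow> E x \<inter> E y = {})"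
  proof (rule level_selection[OF N \<open>0 < K\<close>])
    show "4 * N * K \<le> 2 ^ M" using M by (simp add: K_def)
    show "M \<le> lv x" if "x \<in> X" for x using that by (auto simp: X_def lv_def)
    show "finite (A x)" if "x \<in> X" for x
      using that finf by (auto simp: X_def A_def finfuns_def)
    show "n0 (lv x) \<le> K * card (A x)" if xX: "x \<in> X" for x
    proof -
      obtain k j where x: "x = (k,j)" "k < N" using xX by (auto simp: X_def)
      have "n0 (l k j) \<le> 2 ^ s k * card (A x)"
        using lev[OF x(2)] x by (auto simp: leveled_def A_def)
      also have "2 ^ s k \<le> (2::nat) ^ t" using t[OF x(2)] by simp
      also have "(2::nat) ^ t \<le> 1 * (c + 2 ^ t)" by simp
      also have "\<dots> \<le> K" unfolding K_def using N(2) by (intro mult_le_mono1) simp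
      finally show ?thesis using x by (simp add: lv_def)
    qed
    \<comment> \<open>Within one condition the domains are disjoint, so a pair whose domain contains
      \<open>i\<close> is determined by its first component.\<close>
    show "card {x\<in>X. lv x = m \<and> i \<in> A x} \<le> N" for i m
    proof -
      have "j = j'" if "k < N" "i \<in> dom (q k (Suc j))" "i \<in> dom (q k (Suc j'))" for k j j'
        using disj[OF that(1), of "Suc j" "Suc j'"] that by auto
      then have "inj_on fst {x\<in>X. lv x = m \<and> i \<in> A x}"
        unfolding inj_on_def X_def A_def by auto
      then have "card {x\<in>X. lv x = m \<and> i \<in> A x} \<le> card {..<N}"
        by (rule card_inj_on_le) (auto simp: X_def)
      then show ?thesis by simp
    qed
  qed (use Xlev finD cardD in \<open>simp_all add: S_def\<close>)
  then obtain E where E0: "\<forall>x\<in>X. E x \<subseteq> A x - D \<and> n0 (lv x) \<le> 2 ^ M * card (E x)"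
    "\<forall>x\<in>X. \<forall>y\<in>X. x \<noteq> y \<longrightarrow> E x \<inter> E y = {}"
    by (elim exE conjE)
  then have E: "\<And>x. x \<in> X \<Longrightarrow> E x \<subseteq> A x - D"
    "\<And>x. x \<in> X \<Longrightarrow> n0 (lv x) \<le> 2 ^ M * card (E x)"
    "\<And>x y. x \<in> X \<Longrightarrow> y \<in> X \<Longrightarrow> x \<noteq> y \<Longrightarrow> E x \<inter> E y = {}"
    by auto
  \<comment> \<open>The sequence of the new condition is indexed by all natural numbers, so
    \<open>X\<close> must be enumerated bijectively. It is infinite because already the condition
    with index 0 has only finitely many \<open>\<sigma>\<close> of level below
    \<open>M\<close>.\<close>
  have "infinite X"
  proof
    assume "finite X"
    moreover have "Pair 0 ` {j. M \<le> l 0 j} \<subseteq> X"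
      using N(2) by (auto simp: X_def)
    ultimately have "finite (Pair (0::nat) ` {j. M \<le> l 0 j})" by (rule rev_finite_subset)
    then have "finite {j. M \<le> l 0 j}" by (simp add: finite_image_iff inj_on_def)
    with low(1)[OF N(2), of M] have "finite ({j. M \<le> l 0 j} \<union> {j. l 0 j < M})" by simp
    moreover have "{j. M \<le> l 0 j} \<union> {j. l 0 j < M} = UNIV" by auto
    ultimately show False by simp
  qed
  then have bij: "bij_betw (from_nat_into X) UNIV X"
    by (intro bij_betw_from_nat_into) auto
  define g where "g = from_nat_into X"
  have gX: "g i \<in> X" for i using bij by (auto simp: g_def bij_betw_def)
  have ginj: "g i = g j \<longleftrightarrow> i = j" for i j using bij by (auto simp: g_def bij_betw_def inj_eq)
  define r where "r n = (case n of 0 \<Rightarrow> (Some \<circ> \<eta>) |` D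
      | Suc i \<Rightarrow> q (fst (g i)) (Suc (snd (g i))) |` E (g i))" for n
  have r0: "r 0 = (Some \<circ> \<eta>) |` D" and rS: "r (Suc i) = q (fst (g i)) (Suc (snd (g i))) |` E (g i)" for i
    by (simp_all add: r_def)
  have dom0: "dom (r 0) = D" by (auto simp: r0)
  have domS: "dom (r (Suc i)) = E (g i)" for i
    using E(1)[OF gX, of i] by (auto simp: rS A_def split: prod.splits)
  have "r \<in> QH n0 n1 H"
    unfolding QH_iff
  proof (intro conjI allI impI exI)
    show "r n \<in> finfuns H" for n
    proof (cases n)
      case 0
      then show ?thesis using dom0 finD \<eta>(1)
        by (auto simp: r0 finfuns_def restrict_map_def simp del: dom_restrict split: if_splits)
    next
      case (Suc i)
      have "q (fst (g i)) (Suc (snd (g i))) \<in> finfuns H"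
        using gX[of i] finf by (auto simp: X_def)
      then show ?thesis
        unfolding Suc rS by (rule finfuns_restrict)
    qed
    have SS: "dom (r (Suc i)) \<inter> dom (r (Suc j)) = {}" if "i \<noteq> j" for i j
      unfolding domS using E(3)[OF gX gX] ginj that by simp
    have OS: "dom (r 0) \<inter> dom (r (Suc j)) = {}" for j
      using E(1)[OF gX, of j] unfolding domS dom0 by blast
    show "dom (r i) \<inter> dom (r j) = {}" if "i \<noteq> j" for i j
      using that SS OS by (cases i; cases j) (auto simp: Int_commute)
    \<comment> \<open>The old levels are kept and \<open>M\<close> is the new \<open>m*\<close>: all
      levels are at least \<open>M\<close>, the sets \<open>E\<close> lose at most the factor
      \<open>2 ^ M\<close>, and \<open>K \<le> 2 ^ M\<close> absorbs the number of sets on a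
      level.\<close>
    show "leveled n0 n1 r M (lv \<circ> g)"
      unfolding leveled_def
    proof (intro conjI allI)
      show "M \<le> (lv \<circ> g) i" for i using gX[of i] by (auto simp: X_def lv_def)
      show "n0 ((lv \<circ> g) i) \<le> 2 ^ M * card (dom (r (Suc i)))" for i
        using E(2)[OF gX[of i]] by (simp add: domS)
      have img: "g ` {i. (lv \<circ> g) i = m} \<subseteq> {x\<in>X. lv x = m}" for m
        using gX by auto
      have injg: "inj_on g S" for S using ginj by (auto simp: inj_on_def)
      show "finite {i. (lv \<circ> g) i = m}" for m
        using finite_subset[OF img Xlev(1)] injg finite_image_iff by blast
      have KM: "K \<le> 2 ^ M"
      proof -
        have "1 * K \<le> (4 * N) * K" using N(2) by (intro mult_le_mono1) simp
        also have "\<dots> \<le> 2 ^ M" using M by (simp only: K_def)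
        finally show ?thesis by simp
      qed
      have "card {i. (lv \<circ> g) i = m} \<le> card {x\<in>X. lv x = m}" for m
        by (rule card_inj_on_le[OF injg img Xlev(1)])
      then show "card {i. (lv \<circ> g) i = m} \<le> n1 m * 2 ^ M" for m
        using Xlev(2)[of m] mult_le_mono1[OF KM, of "n1 m"] unfolding mult.commute[of "n1 m"] by (meson le_trans)
    qed
  qed
  moreover have "leQ H (q k) r" if "k < N" for k
    unfolding leQ_def
  proof
    fix \<theta> assume \<theta>: "\<theta> \<in> POS H r"
    then have \<theta>D: "\<theta> i = \<eta> i" if "i \<in> D" for i
    proof -
      have "(Some \<circ> \<eta>) |` D \<subseteq>\<^sub>m Some \<circ> \<theta>"
        using \<theta> by (simp add: POS_def r0)
      moreover have "i \<in> dom ((Some \<circ> \<eta>) |` D)" using that dom0 r0 by simp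
      ultimately have "((Some \<circ> \<eta>) |` D) i = (Some \<circ> \<theta>) i"
        unfolding map_le_def by blast
      then show ?thesis using that by (simp add: restrict_in)
    qed
    have "q k 0 \<subseteq>\<^sub>m Some \<circ> \<theta>"
      unfolding map_le_def
    proof
      fix i assume i: "i \<in> dom (q k 0)"
      then have "\<theta> i = \<eta> i" using that by (intro \<theta>D) (auto simp: D_def)
      then show "q k 0 i = (Some \<circ> \<theta>) i"
        using \<eta>(2)[OF that] i by (auto simp: map_le_def)
    qed
    moreover have "\<not> q k (Suc j) \<subseteq>\<^sub>m Some \<circ> \<theta>" for j
    proof (cases "l k j < M")
      case True
      then have z: "(k,j) \<in> Lw" using that by (auto simp: Lw_def)
      then have "\<theta> (d (k,j)) = \<eta> (d (k,j))" by (intro \<theta>D) (auto simp: D_def)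
      then show ?thesis using d[OF z] by (auto simp: map_le_def intro!: bexI[of _ "d (k,j)"])
    next
      case False
      then have "(k,j) \<in> X" using that by (auto simp: X_def)
      then obtain i where i: "g i = (k,j)"
        using bij by (metis bij_betw_imp_surj_on g_def imageE)
      have "\<not> r (Suc i) \<subseteq>\<^sub>m Some \<circ> \<theta>" using \<theta> by (auto simp: POS_def)
      moreover have "r (Suc i) \<subseteq>\<^sub>m q k (Suc j)"
        by (auto simp: rS i map_le_def restrict_in)
      ultimately show ?thesis using map_le_trans by blast
    qed
    ultimately show "\<theta> \<in> POS H (q k)" using \<theta> by (auto simp: POS_def)
  qed
  ultimately show ?thesis by blast
qed

section \<open>Linkedness and compatibility\<close>

lemma countable_finfuns:
  assumes "\<And>i. countable (H i)"
  shows "countable (finfuns H)"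
proof -
  define G where "G f = {(i, x). f i = Some x}" for f :: "nat \<Rightarrow> 'a option"
  have "G f \<in> {S. finite S \<and> S \<subseteq> Sigma UNIV H}" if "f \<in> finfuns H" for f
  proof -
    have "G f = (\<lambda>i. (i, the (f i))) ` dom f"
      by (force simp: G_def)
    then show ?thesis using that by (auto simp: finfuns_def G_def)
  qed
  then have "G ` finfuns H \<subseteq> {S. finite S \<and> S \<subseteq> Sigma UNIV H}"
    by blast
  moreover have "countable {S. finite S \<and> S \<subseteq> Sigma (UNIV :: nat set) H}"
    using assms by (intro countable_Collect_finite_subset countable_SIGMA) auto
  ultimately have "countable (G ` finfuns H)"
    by (rule countable_subset)
  moreover have "inj G"
  proof (rule injI, rule ext)
    fix f g i assume "G f = G g"
    then have "f i = Some x \<longleftrightarrow> g i = Some x" for x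
      by (auto simp: G_def set_eq_iff)
    then show "f i = g i" by (metis not_Some_eq)
  qed
  ultimately show ?thesis
    using countable_image_inj_on inj_on_subset by blast
qed

lemma sigma_star_linked_QH:
  fixes H :: "nat \<Rightarrow> 'a set"
  assumes N: "in_N n0 n1" and cH: "\<And>i. countable (H i)"
    and H: "\<And>i. \<exists>x y. x \<in> H i \<and> y \<in> H i \<and> x \<noteq> y"
  shows "sigma_star_linked (QH n0 n1 H) (leQ H)"
  unfolding sigma_star_linked_def
proof
  fix n :: nat
  let ?P = "QH n0 n1 H"
  have "\<forall>p\<in>?P. \<exists>x. leveled n0 n1 p (fst x) (snd x)"
    by (auto simp: QH_iff)
  then obtain x where x: "\<And>p. p \<in> ?P \<Longrightarrow> leveled n0 n1 p (fst (x p)) (snd (x p))"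
    by metis
  define s where "s p = fst (x p)" for p
  define l where "l p = snd (x p)" for p
  have lev: "leveled n0 n1 p (s p) (l p)" if "p \<in> ?P" for p
    using x that by (simp add: s_def l_def)
  \<comment> \<open>The bound required by \<open>common_upper_bound\<close> for the
    \<open>Suc n\<close> conditions with indices \<open>0\<close> to \<open>n\<close>; it suffices
    since \<open>b < 2 ^ b\<close>. It depends on \<open>p\<close> only through \<open>s p\<close>
    and \<open>p 0\<close>, so conditions with equal codes have the same bound.\<close>
  define M where "M p = 4 * Suc n * (Suc n * (card (dom (p 0)) + 2 ^ s p))" for p :: "'a seqfun"
  \<comment> \<open>Conditions with equal codes share \<open>w\<close> and all \<open>\<sigma>\<close> below level \<open>M\<close>, so a point of \<open>POS\<close> of one of
    them serves all of them.\<close>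
  define code where "code p = (s p, p 0, (\<lambda>j. p (Suc j)) ` {j. l p j < M p})" for p
  define C where "C = (UNIV :: nat set) \<times> finfuns H \<times> {F. finite F \<and> F \<subseteq> finfuns H}"
  have "countable C"
    unfolding C_def using countable_finfuns[OF cH]
    by (intro countable_SIGMA countable_Collect_finite_subset) auto
  have codeC: "code p \<in> C" if "p \<in> ?P" for p
  proof -
    have "{j. l p j < M p} = (\<Union>m\<in>{..<M p}. {j. l p j = m})" by auto
    then have "finite {j. l p j < M p}"
      using lev[OF that] by (simp add: leveled_def)
    then show ?thesis using that by (auto simp: code_def C_def QH_iff)
  qed
  define A where "A i = {p \<in> ?P. to_nat_on C (code p) = i}" for i
  have "\<exists>r\<in>?P. \<forall>k\<le>n. leQ H (q k) r" if q: "\<And>k. k \<le> n \<Longrightarrow> q k \<in> A i" for q i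
  proof -
    have qP: "q k \<in> ?P" if "k \<le> n" for k
      using q[OF that] by (simp add: A_def)
    have codeq: "code (q k) = code (q 0)" if "k \<le> n" for k
    proof (rule inj_onD[OF inj_on_to_nat_on[OF \<open>countable C\<close>]])
      show "to_nat_on C (code (q k)) = to_nat_on C (code (q 0))"
        using q[OF that] q[of 0] by (simp add: A_def)
    qed (use codeC qP that in auto)
    have eq: "s (q k) = s (q 0)" "q k 0 = q 0 0"
      "(\<lambda>j. q k (Suc j)) ` {j. l (q k) j < M (q k)} = (\<lambda>j. q 0 (Suc j)) ` {j. l (q 0) j < M (q 0)}"
      if "k \<le> n" for k
      using codeq[OF that] unfolding code_def prod.inject by simp_all
    have Meq: "M (q k) = M (q 0)" if "k \<le> n" for k
      unfolding M_def eq(1)[OF that] eq(2)[OF that] ..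
    obtain \<eta> where \<eta>: "\<eta> \<in> POS H (q 0)"
      using POS_nonempty[where H = H, OF N H qP[of 0]] by blast
    have "\<exists>r\<in>?P. \<forall>k<Suc n. leQ H (q k) r"
    proof (rule common_upper_bound[where s = "\<lambda>k. s (q k)" and l = "\<lambda>k. l (q k)"
          and t = "s (q 0)" and c = "card (dom (q 0 0))" and M = "M (q 0)" and \<eta> = \<eta>, OF N])
      show "4 * Suc n * (Suc n * (card (dom (q 0 0)) + 2 ^ s (q 0))) \<le> 2 ^ M (q 0)"
        unfolding M_def by (rule less_imp_le[OF less_exp])
      show "\<eta> i \<in> H i" for i using \<eta> by (simp add: POS_def)
      show "q k 0 \<subseteq>\<^sub>m Some \<circ> \<eta>" if "k < Suc n" for k
        using \<eta> that unfolding eq(2)[OF that[unfolded less_Suc_eq_le]] by (simp add: POS_def)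
      show "\<not> q k (Suc j) \<subseteq>\<^sub>m Some \<circ> \<eta>" if "k < Suc n" "l (q k) j < M (q 0)" for k j
      proof -
        have k: "k \<le> n" using that(1) by simp
        have "l (q k) j < M (q k)" unfolding Meq[OF k] by (rule that(2))
        then have "q k (Suc j) \<in> (\<lambda>j. q k (Suc j)) ` {j. l (q k) j < M (q k)}" by blast
        then have "q k (Suc j) \<in> (\<lambda>j. q 0 (Suc j)) ` {j. l (q 0) j < M (q 0)}"
          unfolding eq(3)[OF k] .
        then show ?thesis using \<eta> by (auto simp: POS_def)
      qed
      show "s (q k) \<le> s (q 0)" "card (dom (q k 0)) \<le> card (dom (q 0 0))" if "k < Suc n" for k
        using eq(1,2)[of k] that by simp_all
    qed (use qP lev in \<open>simp_all add: less_Suc_eq_le\<close>)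
    then show ?thesis by (simp add: less_Suc_eq_le)
  qed
  then have bound: "\<forall>i. \<forall>q :: nat \<Rightarrow> 'a seqfun. (\<forall>k\<le>n. q k \<in> A i) \<longrightarrow> (\<exists>r\<in>?P. \<forall>k\<le>n. leQ H (q k) r)"
    by blast
  show "\<exists>A :: nat \<Rightarrow> 'a seqfun set. (\<forall>i j. i \<noteq> j \<longrightarrow> A i \<inter> A j = {}) \<and> (\<Union>i. A i) = ?P \<and>
        (\<forall>i. \<forall>q :: nat \<Rightarrow> 'a seqfun. (\<forall>k\<le>n. q k \<in> A i) \<longrightarrow> (\<exists>r\<in>?P. \<forall>k\<le>n. leQ H (q k) r))"
    by (rule exI[of _ A], intro conjI bound) (auto simp: A_def)
qed

text \<open>For \<open>n = 1\<close> any two members of a piece are compatible, so an antichain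
  meets each of the countably many pieces at most once.\<close>

lemma ccc_if_sigma_star_linked:
  assumes "sigma_star_linked P le"
  shows "ccc P le"
  unfolding ccc_def
proof (intro allI impI)
  fix B assume B: "B \<subseteq> P" "\<forall>p\<in>B. \<forall>q\<in>B. p \<noteq> q \<longrightarrow> \<not> compatible_in P le p q"
  obtain A :: "nat \<Rightarrow> 'a set" where A: "(\<Union>i. A i) = P"
    "\<And>i q. (\<forall>k\<le>1::nat. q k \<in> A i) \<Longrightarrow> \<exists>r\<in>P. \<forall>k\<le>1::nat. le (q k) r"
    using assms[unfolded sigma_star_linked_def, rule_format, of 1] by blast
  have "\<forall>p\<in>B. \<exists>i. p \<in> A i" using A(1) B(1) by blast
  then obtain ix where ix: "\<And>p. p \<in> B \<Longrightarrow> p \<in> A (ix p)" by metis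
  have "inj_on ix B"
  proof (rule inj_onI, rule ccontr)
    fix p q assume pq: "p \<in> B" "q \<in> B" "ix p = ix q" "p \<noteq> q"
    have "\<forall>k\<le>1::nat. (if k = 0 then p else q) \<in> A (ix p)"
      using ix[OF pq(1)] ix[OF pq(2)] pq(3) by auto
    from A(2)[OF this]
    obtain r where r: "r \<in> P" "\<And>k. k \<le> 1 \<Longrightarrow> le (if k = (0::nat) then p else q) r"
      by blast
    have "compatible_in P le p q"
      unfolding compatible_in_def using r(1) r(2)[of 0] r(2)[of 1] by auto
    then show False using B(2) pq by blast
  qed
  then show "countable B" by (rule countableI)
qed

text \<open>A finite approximation to a common point of \<open>POS H p\<close> and
  \<open>POS H q\<close>. For fixed \<open>n\<close> it depends only on the first
  \<open>Suc n\<close> entries of \<open>p\<close> and \<open>q\<close>, so it is a clopen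
  relation.\<close>

definition finitely_met :: "(nat \<Rightarrow> 'a set) \<Rightarrow> 'a seqfun \<Rightarrow> 'a seqfun \<Rightarrow> nat \<Rightarrow> bool" where
  "finitely_met H p q n \<longleftrightarrow> (\<exists>\<eta>. (\<forall>i. \<eta> i \<in> H i) \<and> p 0 \<subseteq>\<^sub>m Some \<circ> \<eta> \<and> q 0 \<subseteq>\<^sub>m Some \<circ> \<eta> \<and>
     (\<forall>j<n. \<not> p (Suc j) \<subseteq>\<^sub>m Some \<circ> \<eta> \<and> \<not> q (Suc j) \<subseteq>\<^sub>m Some \<circ> \<eta>))"

text \<open>Both conditions have only finitely many \<open>\<sigma>\<close> of level below the
  \<open>M\<close> needed for two conditions. One \<open>n\<close> beyond all their indices supplies
  an \<open>\<eta>\<close> for \<open>common_upper_bound\<close>.\<close>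

lemma compatible_if_finitely_met:
  assumes N: "in_N n0 n1" and p: "p \<in> QH n0 n1 H" and q: "q \<in> QH n0 n1 H"
    and fin: "\<And>n. finitely_met H p q n"
  shows "compatible_in (QH n0 n1 H) (leQ H) p q"
proof -
  obtain s l where p_lev: "leveled n0 n1 p s l" using p by (auto simp: QH_iff)
  obtain s' l' where q_lev: "leveled n0 n1 q s' l'" using q by (auto simp: QH_iff)
  define t where "t = max s s'"
  define c where "c = max (card (dom (p 0))) (card (dom (q 0)))"
  define M where "M = 4 * 2 * (2 * (c + 2 ^ t) :: nat)"
  have "{j. l j < M} \<union> {j. l' j < M} = (\<Union>m\<in>{..<M}. {j. l j = m} \<union> {j. l' j = m})"
    by auto
  then have "finite ({j. l j < M} \<union> {j. l' j < M})"
    using p_lev q_lev by (simp add: leveled_def)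
  then obtain n where n: "\<And>j. j \<in> {j. l j < M} \<union> {j. l' j < M} \<Longrightarrow> j < n"
    by (metis finite_nat_set_iff_bounded)
  obtain \<eta> where \<eta>: "\<And>i. \<eta> i \<in> H i" "p 0 \<subseteq>\<^sub>m Some \<circ> \<eta>" "q 0 \<subseteq>\<^sub>m Some \<circ> \<eta>"
    "\<And>j. j < n \<Longrightarrow> \<not> p (Suc j) \<subseteq>\<^sub>m Some \<circ> \<eta>" "\<And>j. j < n \<Longrightarrow> \<not> q (Suc j) \<subseteq>\<^sub>m Some \<circ> \<eta>"
    using fin[of n] unfolding finitely_met_def by blast
  have "\<exists>r\<in>QH n0 n1 H. \<forall>k<2. leQ H (if k = (0::nat) then p else q) r"
  proof (rule common_upper_bound[where s = "\<lambda>k. if k = 0 then s else s'"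
        and l = "\<lambda>k. if k = 0 then l else l'" and t = t and c = c and M = M and \<eta> = \<eta>, OF N])
    show "4 * 2 * (2 * (c + 2 ^ t)) \<le> 2 ^ M"
      unfolding M_def by (rule less_imp_le[OF less_exp])
  qed (use p q p_lev q_lev \<eta> n in \<open>auto simp: t_def c_def split: if_splits\<close>)
  then obtain r where "r \<in> QH n0 n1 H" "\<And>k. k < 2 \<Longrightarrow> leQ H (if k = (0::nat) then p else q) r"
    by blast
  from this(1) this(2)[of 0] this(2)[of 1] show ?thesis
    unfolding compatible_in_def by auto
qed

lemma POS_Int_if_compatible:
  assumes N: "in_N n0 n1" and H: "\<And>i. \<exists>x y. x \<in> H i \<and> y \<in> H i \<and> x \<noteq> y"
    and "compatible_in (QH n0 n1 H) (leQ H) p q"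
  shows "POS H p \<inter> POS H q \<noteq> {}"
  using assms(3) POS_nonempty[where H = H, OF N H] unfolding compatible_in_def leQ_def by blast

lemma finitely_met_if_POS_Int: "POS H p \<inter> POS H q \<noteq> {} \<Longrightarrow> finitely_met H p q n"
  unfolding POS_def finitely_met_def by blast

text \<open>A cycle of implications: an upper bound has a nonempty \<open>POS\<close> contained in
  both, a common point meets every finite part of the requirements, and
  \<open>compatible_if_finitely_met\<close> leads back.\<close>

lemma compatible_iff_POS_Int:
  assumes "in_N n0 n1" "\<And>i. \<exists>x y. x \<in> H i \<and> y \<in> H i \<and> x \<noteq> y"
    and "p \<in> QH n0 n1 H" "q \<in> QH n0 n1 H"
  shows "compatible_in (QH n0 n1 H) (leQ H) p q \<longleftrightarrow> POS H p \<inter> POS H q \<noteq> {}"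
  using POS_Int_if_compatible[where H = H, OF assms(1,2)] compatible_if_finitely_met[OF assms(1,3,4)]
    finitely_met_if_POS_Int by metis

lemma compatible_iff_finitely_met:
  assumes "in_N n0 n1" "\<And>i. \<exists>x y. x \<in> H i \<and> y \<in> H i \<and> x \<noteq> y"
    and "p \<in> QH n0 n1 H" "q \<in> QH n0 n1 H"
  shows "compatible_in (QH n0 n1 H) (leQ H) p q \<longleftrightarrow> (\<forall>n. finitely_met H p q n)"
  using POS_Int_if_compatible[where H = H, OF assms(1,2)] compatible_if_finitely_met[OF assms(1,3,4)]
    finitely_met_if_POS_Int by metis

section \<open>Souslin definability\<close>

text \<open>For a predicate this means clopen. Allowing arbitrary values permits clopen relations to
  be assembled from coordinates by composition.\<close>

abbreviation locally_constant :: "'b topology \<Rightarrow> ('b \<Rightarrow> 'c) \<Rightarrow> bool" where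
  "locally_constant Z f \<equiv> continuous_map Z (discrete_topology UNIV) f"

lemma locally_constant_compose:
  assumes "locally_constant Z f"
  shows "locally_constant Z (\<lambda>z. h (f z))"
proof -
  have "continuous_map (discrete_topology UNIV) (discrete_topology UNIV) h" by simp
  from continuous_map_compose[OF assms this] show ?thesis by (simp add: o_def)
qed

text \<open>The index may vary with \<open>z\<close>: on each open piece where \<open>g\<close>
  equals some \<open>k\<close>, the function is \<open>F z k\<close>.\<close>

lemma locally_constant_apply:
  assumes F: "\<And>k. locally_constant Z (\<lambda>z. F z k)" and g: "locally_constant Z g"
  shows "locally_constant Z (\<lambda>z. F z (g z))"
  unfolding continuous_map_def
proof (intro conjI allI impI)
  fix S :: "'c set"
  have "openin Z ({z \<in> topspace Z. F z k \<in> S} \<inter> {z \<in> topspace Z. g z \<in> {k}})" for k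
    by (intro openin_Int openin_continuous_map_preimage[OF F] openin_continuous_map_preimage[OF g]) auto
  then have "openin Z (\<Union>k. {z \<in> topspace Z. F z k \<in> S} \<inter> {z \<in> topspace Z. g z \<in> {k}})"
    by (intro openin_Union) auto
  moreover have "(\<Union>k. {z \<in> topspace Z. F z k \<in> S} \<inter> {z \<in> topspace Z. g z \<in> {k}})
      = {z \<in> topspace Z. F z (g z) \<in> S}" by auto
  ultimately show "openin Z {z \<in> topspace Z. F z (g z) \<in> S}" by simp
qed simp

lemma locally_constant_compose2:
  assumes "locally_constant Z f" "locally_constant Z g"
  shows "locally_constant Z (\<lambda>z. h (f z) (g z))"
  by (rule locally_constant_apply[OF locally_constant_compose[OF assms(1)] assms(2)])

text \<open>\<open>P\<close> factors through the list of the first \<open>n\<close> values, which is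
  locally constant by induction on its length. The factor evaluates \<open>P\<close> at some point
  with the given list.\<close>

lemma locally_constant_if_finitely_determined:
  assumes F: "\<And>k. locally_constant Z (\<lambda>z. F z (k::nat))"
    and P: "\<And>z z'. (\<And>k. k < n \<Longrightarrow> F z k = F z' k) \<Longrightarrow> P z = P z'"
  shows "locally_constant Z P"
proof -
  have "locally_constant Z (\<lambda>z. map (F z) [0..<m])" for m
  proof (induction m)
    case (Suc m)
    show ?case
      using locally_constant_compose2[OF Suc F[of m], of "\<lambda>xs x. xs @ [x]"] by simp
  qed simp
  then have "locally_constant Z (\<lambda>z. P (SOME z'. map (F z') [0..<n] = map (F z) [0..<n]))"
    by (rule locally_constant_compose)
  moreover have "P (SOME z'. map (F z') [0..<n] = map (F z) [0..<n]) = P z" for z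
  proof (rule P)
    have "map (F (SOME z'. map (F z') [0..<n] = map (F z) [0..<n])) [0..<n] = map (F z) [0..<n]"
      by (rule someI[of _ z]) (rule refl)
    then show "F (SOME z'. map (F z') [0..<n] = map (F z) [0..<n]) k = F z k" if "k < n" for k
      using that unfolding map_eq_conv by simp
  qed
  ultimately show ?thesis by simp
qed

lemma locally_constant_continuous_map:
  assumes "continuous_map Z X h" "locally_constant X f"
  shows "locally_constant Z (\<lambda>z. f (h z))"
  using continuous_map_compose[OF assms] by (simp add: o_def)

lemma locally_constant_fst:
  "locally_constant X f \<Longrightarrow> locally_constant (prod_topology X Y) (\<lambda>z. f (fst z))"
  by (rule locally_constant_continuous_map[OF continuous_map_fst])

lemma locally_constant_snd:
  "locally_constant Y f \<Longrightarrow> locally_constant (prod_topology X Y) (\<lambda>z. f (snd z))"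
  by (rule locally_constant_continuous_map[OF continuous_map_snd])

lemma locally_constant_coordinate:
  "locally_constant (product_topology (\<lambda>_. discrete_topology S) UNIV) (\<lambda>x. x k)"
proof (rule locally_constant_continuous_map)
  show "continuous_map (product_topology (\<lambda>_. discrete_topology S) UNIV) (discrete_topology S) (\<lambda>x. x k)"
    by (rule continuous_map_product_coordinates) simp
  show "locally_constant (discrete_topology S) (\<lambda>x. x)"
    by simp
qed

lemma locally_constant_cond_space: "locally_constant (cond_space H) (\<lambda>p. p k)"
  unfolding cond_space_def by (rule locally_constant_coordinate)

lemma locally_constant_baire_space: "locally_constant baire_space (\<lambda>y. y k)"
  unfolding baire_space_def by (rule locally_constant_coordinate)

section \<open>Closed predicates and analytic sets\<close>

definition closed_pred :: "'b topology \<Rightarrow> ('b \<Rightarrow> bool) \<Rightarrow> bool" where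
  "closed_pred Z P \<longleftrightarrow> closedin Z {z \<in> topspace Z. P z}"

lemma closed_pred_locally_constant: "locally_constant Z P \<Longrightarrow> closed_pred Z P"
  unfolding closed_pred_def
  using closedin_continuous_map_preimage[of Z "discrete_topology UNIV" P "{True}"] by simp

lemma closed_pred_conj:
  assumes "closed_pred Z P" "closed_pred Z Q"
  shows "closed_pred Z (\<lambda>z. P z \<and> Q z)"
proof -
  have "{z \<in> topspace Z. P z \<and> Q z} = {z \<in> topspace Z. P z} \<inter> {z \<in> topspace Z. Q z}" by auto
  then show ?thesis
    using assms unfolding closed_pred_def by (simp add: closedin_Int)
qed

lemma closed_pred_all:
  assumes "\<And>j. closed_pred Z (\<lambda>z. P z j)"
  shows "closed_pred Z (\<lambda>z. \<forall>j. P z j)"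
proof -
  have "closedin Z (\<Inter>j. {z \<in> topspace Z. P z j})"
    using assms unfolding closed_pred_def by (intro closedin_Inter) auto
  moreover have "(\<Inter>j. {z \<in> topspace Z. P z j}) = {z \<in> topspace Z. \<forall>j. P z j}" by auto
  ultimately show ?thesis by (simp add: closed_pred_def)
qed

lemma sigma11_inI:
  assumes "closed_pred (prod_topology X baire_space) (\<lambda>z. R (fst z) (snd z))"
  shows "sigma11_in X {x \<in> topspace X. \<exists>y. R x y}"
proof -
  have "topspace baire_space = UNIV"
    by (simp add: baire_space_def)
  then have "{x \<in> topspace X. \<exists>y. R x y}
      = fst ` {z \<in> topspace (prod_topology X baire_space). R (fst z) (snd z)}"
    by force
  then show ?thesis
    using assms unfolding sigma11_in_def closed_pred_def by blast
qed

lemma sigma11_in_subset: "sigma11_in X A \<Longrightarrow> A \<subseteq> topspace X"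
  unfolding sigma11_in_def by (auto dest!: closedin_subset)

text \<open>The closed set in the product is pulled back along \<open>f\<close> times the
  identity.\<close>

lemma sigma11_in_preimage:
  assumes f: "continuous_map X Y f" and A: "sigma11_in Y A"
  shows "sigma11_in X {x \<in> topspace X. f x \<in> A}"
proof -
  obtain C where C: "closedin (prod_topology Y baire_space) C" "A = fst ` C"
    using A unfolding sigma11_in_def by blast
  have "continuous_map (prod_topology X baire_space) (prod_topology Y baire_space) (\<lambda>z. (f (fst z), snd z))"
    using continuous_map_compose[OF continuous_map_fst f]
    by (intro continuous_map_pairedI continuous_map_snd) (simp add: o_def)
  then have "closed_pred (prod_topology X baire_space) (\<lambda>z. (f (fst z), snd z) \<in> C)"
    unfolding closed_pred_def by (rule closedin_continuous_map_preimage[OF _ C(1)])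
  then have "sigma11_in X {x \<in> topspace X. \<exists>y. (f x, y) \<in> C}"
    by (rule sigma11_inI)
  moreover have "(\<exists>y. (f x, y) \<in> C) \<longleftrightarrow> f x \<in> A" for x
    unfolding C(2) by force
  ultimately show ?thesis by simp
qed

lemma continuous_map_baire_space_reindex:
  "continuous_map baire_space baire_space (\<lambda>y n. y (h n))"
  unfolding baire_space_def continuous_map_componentwise_UNIV
  by (intro allI continuous_map_product_coordinates UNIV_I)

text \<open>One point of Baire space carries both witnesses, in its even and its odd
  entries.\<close>

lemma sigma11_in_Int:
  assumes A: "sigma11_in X A" and B: "sigma11_in X B"
  shows "sigma11_in X (A \<inter> B)"
proof -
  obtain C D where C: "closedin (prod_topology X baire_space) C" "A = fst ` C"
    and D: "closedin (prod_topology X baire_space) D" "B = fst ` D"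
    using A B unfolding sigma11_in_def by blast
  let ?Z = "prod_topology X baire_space"
  have cont: "continuous_map ?Z ?Z (\<lambda>z. (fst z, \<lambda>n. snd z (h n)))" for h
    using continuous_map_compose[OF continuous_map_snd continuous_map_baire_space_reindex[of h]]
    by (intro continuous_map_pairedI continuous_map_fst) (simp add: o_def)
  have "closed_pred ?Z (\<lambda>z. (fst z, \<lambda>n. snd z (2 * n)) \<in> C \<and> (fst z, \<lambda>n. snd z (2 * n + 1)) \<in> D)"
    by (rule closed_pred_conj; unfold closed_pred_def)
      (rule closedin_continuous_map_preimage[OF cont] C(1) D(1))+
  then have "sigma11_in X {x \<in> topspace X. \<exists>y. (x, \<lambda>n. y (2 * n)) \<in> C \<and> (x, \<lambda>n. y (2 * n + 1)) \<in> D}"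
    by (rule sigma11_inI)
  moreover have "(\<exists>y. (x, \<lambda>n. y (2 * n)) \<in> C \<and> (x, \<lambda>n. y (2 * n + 1)) \<in> D) \<longleftrightarrow> x \<in> A \<inter> B" for x
  proof
    assume "x \<in> A \<inter> B"
    then obtain a b where ab: "(x, a) \<in> C" "(x, b) \<in> D"
      unfolding C(2) D(2) by force
    define y where "y k = (if even k then a (k div 2) else b (k div 2))" for k
    have "(\<lambda>n. y (2 * n)) = a" "(\<lambda>n. y (2 * n + 1)) = b"
      by (auto simp: y_def)
    then show "\<exists>y. (x, \<lambda>n. y (2 * n)) \<in> C \<and> (x, \<lambda>n. y (2 * n + 1)) \<in> D"
      using ab by metis
  qed (unfold C(2) D(2), force)
  moreover have "A \<inter> B \<subseteq> topspace X" using sigma11_in_subset[OF A] by blast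
  ultimately show ?thesis by (simp add: Collect_conj_eq Int_absorb1 Int_commute)
qed

text \<open>Finiteness alone is not a closed condition on a set of naturals; with a bound on the
  size it becomes a conjunction of conditions on initial segments, each of which is clopen.\<close>

lemma finite_card_le_iff_initial_segments:
  fixes S :: "nat set"
  shows "finite S \<and> card S \<le> b \<longleftrightarrow> (\<forall>n. card (S \<inter> {..<n}) \<le> b)"
proof
  assume "finite S \<and> card S \<le> b"
  then show "\<forall>n. card (S \<inter> {..<n}) \<le> b"
    by (meson card_mono inf_le1 le_trans)
next
  assume R: "\<forall>n. card (S \<inter> {..<n}) \<le> b"
  have le: "card F \<le> b" if "finite F" "F \<subseteq> S" for F
  proof -
    from that(1) obtain n where "F \<subseteq> {..<n}"
      unfolding finite_nat_iff_bounded ..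
    then have "card F \<le> card (S \<inter> {..<n})"
      using that(2) by (intro card_mono) auto
    also have "\<dots> \<le> b" using R ..
    finally show ?thesis .
  qed
  have "finite S"
  proof (rule ccontr)
    assume "infinite S"
    then obtain F where "F \<subseteq> S" "finite F" "card F = Suc b"
      using infinite_arbitrarily_large[of S "Suc b"] by blast
    then show False using le[of F] by simp
  qed
  then show "finite S \<and> card S \<le> b" using le by blast
qed

section \<open>Complexity of the conditions, the order and incompatibility\<close>

lemma topspace_cond_space: "p \<in> topspace (cond_space H) \<longleftrightarrow> (\<forall>k. p k \<in> finfuns H)"
  by (auto simp: cond_space_def PiE_iff)

text \<open>A single point of Baire space codes \<open>m*\<close> as entry 0 and the level function
  in the later entries. Each instance of a clause then looks at finitely many entries.\<close>

lemma closed_pred_leveled: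
  "closed_pred (prod_topology (cond_space H) baire_space)
     (\<lambda>z. leveled n0 n1 (fst z) (snd z 0) (\<lambda>j. snd z (Suc j)))"
proof -
  let ?Z = "prod_topology (cond_space H) baire_space"
  have p: "locally_constant ?Z (\<lambda>z. fst z k)" for k
    by (rule locally_constant_fst[OF locally_constant_cond_space])
  have y: "locally_constant ?Z (\<lambda>z. snd z k)" for k
    by (rule locally_constant_snd[OF locally_constant_baire_space])
  have "locally_constant ?Z (\<lambda>z. snd z 0 \<le> snd z (Suc j))" for j
    by (rule locally_constant_compose2[OF y y])
  moreover have "locally_constant ?Z
      (\<lambda>z. card ({j. snd z (Suc j) = m} \<inter> {..<n}) \<le> n1 m * 2 ^ snd z 0)" for m n
  \<comment> \<open>The level of \<open>j\<close> is entry \<open>Suc j\<close>, so the levels of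
    all \<open>j < n\<close> together with entry 0 are the first \<open>Suc n\<close>
    entries.\<close>
  proof (rule locally_constant_if_finitely_determined[OF y, where n = "Suc n"])
    fix z z' :: "'a seqfun \<times> (nat \<Rightarrow> nat)"
    assume eq: "\<And>k. k < Suc n \<Longrightarrow> snd z k = snd z' k"
    then have "{j. snd z (Suc j) = m} \<inter> {..<n} = {j. snd z' (Suc j) = m} \<inter> {..<n}"
      by auto
    then show "(card ({j. snd z (Suc j) = m} \<inter> {..<n}) \<le> n1 m * 2 ^ snd z 0)
      = (card ({j. snd z' (Suc j) = m} \<inter> {..<n}) \<le> n1 m * 2 ^ snd z' 0)"
      using eq[of 0] by simp
  qed
  moreover have "locally_constant ?Z
      (\<lambda>z. n0 (snd z (Suc j)) \<le> 2 ^ snd z 0 * card (dom (fst z (Suc j))))" for j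
    by (rule locally_constant_compose2[OF y, where h = "\<lambda>a b. n0 a \<le> b"],
        rule locally_constant_compose2[OF y p, where h = "\<lambda>a f. 2 ^ a * card (dom f)"])
  ultimately show ?thesis
    unfolding leveled_def finite_card_le_iff_initial_segments
    by (intro closed_pred_conj closed_pred_all closed_pred_locally_constant)
qed

lemma sigma11_in_QH: "sigma11_in (cond_space H) (QH n0 n1 H)"
proof -
  let ?Z = "prod_topology (cond_space H) baire_space"
  have p: "locally_constant ?Z (\<lambda>z. fst z k)" for k
    by (rule locally_constant_fst[OF locally_constant_cond_space])
  have "locally_constant ?Z (\<lambda>z. k \<noteq> l \<longrightarrow> dom (fst z k) \<inter> dom (fst z l) = {})" for k l
    by (rule locally_constant_compose2[OF p p, where h = "\<lambda>f g. k \<noteq> l \<longrightarrow> dom f \<inter> dom g = {}"])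
  then have "closed_pred ?Z (\<lambda>z. (\<forall>k l. k \<noteq> l \<longrightarrow> dom (fst z k) \<inter> dom (fst z l) = {}) \<and>
      leveled n0 n1 (fst z) (snd z 0) (\<lambda>j. snd z (Suc j)))"
    by (intro closed_pred_conj closed_pred_all closed_pred_locally_constant closed_pred_leveled)
  then have "sigma11_in (cond_space H) {p \<in> topspace (cond_space H).
      \<exists>y. (\<forall>k l. k \<noteq> l \<longrightarrow> dom (p k) \<inter> dom (p l) = {}) \<and> leveled n0 n1 p (y 0) (\<lambda>j. y (Suc j))}"
    by (rule sigma11_inI)
  moreover have "(\<exists>y. leveled n0 n1 p (y 0) (\<lambda>j. y (Suc j))) \<longleftrightarrow> (\<exists>s l. leveled n0 n1 p s l)"
    for p :: "'a seqfun"
  proof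
    assume "\<exists>s l. leveled n0 n1 p s l"
    then obtain s l where sl: "leveled n0 n1 p s l" by blast
    then show "\<exists>y. leveled n0 n1 p (y 0) (\<lambda>j. y (Suc j))"
      by (intro exI[of _ "case_nat s l"]) simp
  qed blast
  moreover have "QH n0 n1 H = {p. p \<in> QH n0 n1 H}" by simp
  ultimately show ?thesis
    unfolding QH_iff by (simp add: topspace_cond_space)
qed

text \<open>Skolemization: the index \<open>i\<close> depending on \<open>j\<close> is read off as
  entry \<open>j\<close> of the witness, after which only a universal quantifier over clopen
  conditions remains.\<close>

lemma sigma11_in_order:
  "sigma11_in (prod_topology (cond_space H) (cond_space H))
     {x \<in> topspace (prod_topology (cond_space H) (cond_space H)).
       fst x 0 \<subseteq>\<^sub>m snd x 0 \<and>
       (\<forall>j. \<exists>i. \<not> consistent (fst x (Suc j)) (snd x 0) \<or> snd x (Suc i) \<subseteq>\<^sub>m fst x (Suc j))}"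
proof -
  let ?X = "prod_topology (cond_space H) (cond_space H)"
  let ?Z = "prod_topology ?X baire_space"
  have p: "locally_constant ?Z (\<lambda>z. fst (fst z) k)" for k
    by (intro locally_constant_fst[of ?X "\<lambda>x. fst x k"]
        locally_constant_fst[of _ "\<lambda>p. p k"] locally_constant_cond_space)
  have q: "locally_constant ?Z (\<lambda>z. snd (fst z) k)" for k
    by (intro locally_constant_fst[of ?X "\<lambda>x. snd x k"]
        locally_constant_snd[of _ "\<lambda>p. p k"] locally_constant_cond_space)
  have y: "locally_constant ?Z (\<lambda>z. snd z k)" for k
    by (rule locally_constant_snd[OF locally_constant_baire_space])
  have qy: "locally_constant ?Z (\<lambda>z. snd (fst z) (Suc (snd z j)))" for j
    by (rule locally_constant_apply[of _ "\<lambda>z i. snd (fst z) (Suc i)", OF q y])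
  have 1: "locally_constant ?Z (\<lambda>z. fst (fst z) 0 \<subseteq>\<^sub>m snd (fst z) 0)"
    by (rule locally_constant_compose2[OF p q])
  have 2: "locally_constant ?Z (\<lambda>z. \<not> consistent (fst (fst z) (Suc j)) (snd (fst z) 0) \<or>
      snd (fst z) (Suc (snd z j)) \<subseteq>\<^sub>m fst (fst z) (Suc j))" for j
    by (rule locally_constant_compose2[where h = "(\<or>)"])
      (rule locally_constant_compose2[OF p q, where h = "\<lambda>f g. \<not> consistent f g"]
        locally_constant_compose2[OF qy p])+
  have "closed_pred ?Z (\<lambda>z. fst (fst z) 0 \<subseteq>\<^sub>m snd (fst z) 0 \<and>
      (\<forall>j. \<not> consistent (fst (fst z) (Suc j)) (snd (fst z) 0) \<or>
        snd (fst z) (Suc (snd z j)) \<subseteq>\<^sub>m fst (fst z) (Suc j)))"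
    by (intro closed_pred_conj closed_pred_all closed_pred_locally_constant 1 2)
  then have "sigma11_in ?X {x \<in> topspace ?X. \<exists>y. fst x 0 \<subseteq>\<^sub>m snd x 0 \<and>
      (\<forall>j. \<not> consistent (fst x (Suc j)) (snd x 0) \<or> snd x (Suc (y j)) \<subseteq>\<^sub>m fst x (Suc j))}"
    by (rule sigma11_inI)
  then show ?thesis unfolding choice_iff by (simp only: ex_simps)
qed

text \<open>A countable union of clopen sets, with \<open>n\<close> supplied by entry 0 of the
  witness.\<close>

lemma sigma11_in_not_finitely_met:
  "sigma11_in (prod_topology (cond_space H) (cond_space H))
     {x \<in> topspace (prod_topology (cond_space H) (cond_space H)).
       \<exists>n. \<not> finitely_met H (fst x) (snd x) n}"
proof -
  let ?X = "prod_topology (cond_space H) (cond_space H)"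
  let ?Z = "prod_topology ?X baire_space"
  have pq: "locally_constant ?X (\<lambda>x. (fst x k, snd x k))" for k
    by (intro locally_constant_compose2[where h = Pair] locally_constant_fst[of _ "\<lambda>p. p k"]
        locally_constant_snd[of _ "\<lambda>p. p k"] locally_constant_cond_space)
  have "locally_constant ?X (\<lambda>x. finitely_met H (fst x) (snd x) n)" for n
  proof (rule locally_constant_if_finitely_determined[where F = "\<lambda>x k. (fst x k, snd x k)" and n = "Suc n"])
    fix x x' :: "'a seqfun \<times> 'a seqfun"
    assume "\<And>k. k < Suc n \<Longrightarrow> (fst x k, snd x k) = (fst x' k, snd x' k)"
    then have "fst x k = fst x' k" "snd x k = snd x' k" if "k < Suc n" for k
      using that by auto
    then show "finitely_met H (fst x) (snd x) n = finitely_met H (fst x') (snd x') n"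
      unfolding finitely_met_def by simp
  qed (rule pq)
  then have "locally_constant ?Z (\<lambda>z. finitely_met H (fst (fst z)) (snd (fst z)) n)" for n
    by (rule locally_constant_fst)
  then have "locally_constant ?Z (\<lambda>z. \<not> finitely_met H (fst (fst z)) (snd (fst z)) n)" for n
    by (rule locally_constant_compose[where h = Not])
  then have "locally_constant ?Z (\<lambda>z. \<not> finitely_met H (fst (fst z)) (snd (fst z)) (snd z 0))"
    by (rule locally_constant_apply[OF _ locally_constant_snd[OF locally_constant_baire_space]])
  then have "sigma11_in ?X {x \<in> topspace ?X. \<exists>y :: nat \<Rightarrow> nat. \<not> finitely_met H (fst x) (snd x) (y 0)}"
    by (rule sigma11_inI[OF closed_pred_locally_constant])
  moreover have "(\<exists>y :: nat \<Rightarrow> nat. \<not> finitely_met H (fst x) (snd x) (y 0)) \<longleftrightarrow>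
      (\<exists>n. \<not> finitely_met H (fst x) (snd x) n)" for x :: "'a seqfun \<times> 'a seqfun"
    by (auto intro: exI[of _ "\<lambda>_. n" for n])
  ultimately show ?thesis by simp
qed

text \<open>The descriptions of order and incompatibility hold only between conditions. They are
  therefore analyzed on the whole space and then intersected with the preimages of \<open>P\<close>
  under the two projections.\<close>

lemma sigma11_in_prod_restrict:
  assumes P: "sigma11_in X P"
    and R: "sigma11_in (prod_topology X X) {x \<in> topspace (prod_topology X X). R (fst x) (snd x)}"
  shows "sigma11_in (prod_topology X X) {(p, q). p \<in> P \<and> q \<in> P \<and> R p q}"
proof -
  have "sigma11_in (prod_topology X X)
     ({x \<in> topspace (prod_topology X X). fst x \<in> P} \<inter> {x \<in> topspace (prod_topology X X). snd x \<in> P} \<inter>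
      {x \<in> topspace (prod_topology X X). R (fst x) (snd x)})" (is "sigma11_in _ ?S")
    by (intro sigma11_in_Int R sigma11_in_preimage[OF continuous_map_fst P]
        sigma11_in_preimage[OF continuous_map_snd P])
  moreover have "?S = {(p, q). p \<in> P \<and> q \<in> P \<and> R p q}"
    using sigma11_in_subset[OF P] by auto
  ultimately show ?thesis by simp
qed

lemma souslin_QH:
  assumes N: "in_N n0 n1" and H: "\<And>i. \<exists>x y. x \<in> H i \<and> y \<in> H i \<and> x \<noteq> y"
  shows "souslin (cond_space H) (QH n0 n1 H) (leQ H)"
proof -
  let ?P = "QH n0 n1 H" and ?X = "cond_space H"
  have order: "{(p, q). p \<in> ?P \<and> q \<in> ?P \<and> leQ H p q} = {(p, q). p \<in> ?P \<and> q \<in> ?P \<and> p 0 \<subseteq>\<^sub>m q 0 \<and>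
      (\<forall>j. \<exists>i. \<not> consistent (p (Suc j)) (q 0) \<or> q (Suc i) \<subseteq>\<^sub>m p (Suc j))}"
    using leQ_iff[where H = H, OF N H] by auto
  have incompatible: "{(p, q). p \<in> ?P \<and> q \<in> ?P \<and> \<not> compatible_in ?P (leQ H) p q}
      = {(p, q). p \<in> ?P \<and> q \<in> ?P \<and> (\<exists>n. \<not> finitely_met H p q n)}"
    using compatible_iff_finitely_met[where H = H, OF N H] by auto
  show ?thesis
    unfolding souslin_def order incompatible
    by (intro conjI sigma11_in_subset[OF sigma11_in_QH] sigma11_in_QH
        sigma11_in_prod_restrict[OF sigma11_in_QH sigma11_in_order]
        sigma11_in_prod_restrict[OF sigma11_in_QH sigma11_in_not_finitely_met])
qed

theorem theorem4p3:
  fixes n0 n1 :: "nat \<Rightarrow> nat" and H :: "nat \<Rightarrow> 'a set"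
  assumes "in_N n0 n1"
    and "\<And>i. countable (H i)"
    and "\<And>i. \<exists>x y. x \<in> H i \<and> y \<in> H i \<and> x \<noteq> y"
  shows "sigma_star_linked (QH n0 n1 H) (leQ H) \<and>
         (\<forall>p0\<in>QH n0 n1 H. \<forall>p1\<in>QH n0 n1 H.
           compatible_in (QH n0 n1 H) (leQ H) p0 p1 \<longleftrightarrow> POS H p0 \<inter> POS H p1 \<noteq> {}) \<and>
         souslin_ccc (cond_space H) (QH n0 n1 H) (leQ H)"
proof (intro conjI ballI)
  show linked: "sigma_star_linked (QH n0 n1 H) (leQ H)"
    by (rule sigma_star_linked_QH[OF assms])
  show "compatible_in (QH n0 n1 H) (leQ H) p0 p1 \<longleftrightarrow> POS H p0 \<inter> POS H p1 \<noteq> {}"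
    if "p0 \<in> QH n0 n1 H" "p1 \<in> QH n0 n1 H" for p0 p1
    by (rule compatible_iff_POS_Int[where H = H, OF assms(1,3) that])
  show "souslin_ccc (cond_space H) (QH n0 n1 H) (leQ H)"
    unfolding souslin_ccc_def
    using souslin_QH[where H = H, OF assms(1,3)] ccc_if_sigma_star_linked[OF linked] by blast
qed

end
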